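(* Let $n\geq 2$ and $\alpha>0$. Let $p_1,p_2,p_3\in\mathbb{R}^n$ be three distinct points and let $\zeta_1,\zeta_2,\zeta_3>0$. Then the potential $$V_\alpha(x)=\sum_{i=1}^{3}\zeta_i\,\rho_i(x)^{-\alpha},\qquad \rho_i(x)=\|x-p_i\|^2,\qquad x\in\mathbb{R}^n\setminus\{p_1,p_2,p_3\},$$ has at most $6$ nondegenerate equilibrium points.
   Context: Here $\|\cdot\|$ is the Euclidean norm. An equilibrium point of $V_\alpha$ is a critical point, i.e. a point $x\in\mathbb{R}^n\setminus\{p_1,p_2,p_3\}$ with $\nabla V_\alpha(x)=0$. It is nondegenerate if the Hessian matrix of $V_\alpha$ at $x$ (an $n\times n$ matrix) is invertible. *)

theory Defs
  imports "HOL-Analysis.Analysis"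
begin

text \<open>The gradient as a function of the base point; the relation \<^const>\<open>gderiv\<close> determines it
  uniquely wherever it exists (lemma \<open>gradient_eqI\<close> below).\<close>

definition gradient :: "('a::real_inner \<Rightarrow> real) \<Rightarrow> 'a \<Rightarrow> 'a" where
  "gradient f x = (THE D. GDERIV f x :> D)"

text \<open>The entry in row \<open>i\<close> and column \<open>j\<close> is the \<open>j\<close>-th partial derivative of the \<open>i\<close>-th
  partial derivative of \<open>f\<close>.\<close>

definition hessian :: "(real ^ 'n \<Rightarrow> real) \<Rightarrow> real ^ 'n \<Rightarrow> real ^ 'n ^ 'n" where
  "hessian f x = jacobian (gradient f) (at x)"

text \<open>The charges are \<open>\<zeta> i\<close>, located at \<open>p i\<close>, for \<open>i \<in> {1..3}\<close>; other indices are irrelevant.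
  At the points \<open>p i\<close>, where the potential is undefined mathematically, this total function takes
  an arbitrary value (\<open>0 powr a = 0\<close>); they are excluded explicitly from the equilibria.\<close>

definition potential :: "real \<Rightarrow> (nat \<Rightarrow> real) \<Rightarrow> (nat \<Rightarrow> real ^ 'n) \<Rightarrow> real ^ 'n \<Rightarrow> real" where
  "potential \<alpha> \<zeta> p x = (\<Sum>i=1..3. \<zeta> i * ((norm (x - p i))\<^sup>2) powr (- \<alpha>))"

definition equilibrium ::
  "real \<Rightarrow> (nat \<Rightarrow> real) \<Rightarrow> (nat \<Rightarrow> real ^ 'n) \<Rightarrow> real ^ 'n \<Rightarrow> bool" where
  "equilibrium \<alpha> \<zeta> p x \<longleftrightarrow> x \<notin> p ` {1..3} \<and> GDERIV (potential \<alpha> \<zeta> p) x :> 0"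

definition nondegenerate_equilibrium ::
  "real \<Rightarrow> (nat \<Rightarrow> real) \<Rightarrow> (nat \<Rightarrow> real ^ 'n) \<Rightarrow> real ^ 'n \<Rightarrow> bool" where
  "nondegenerate_equilibrium \<alpha> \<zeta> p x \<longleftrightarrow>
     equilibrium \<alpha> \<zeta> p x \<and> invertible (hessian (potential \<alpha> \<zeta> p) x)"

lemma gradient_eqI:
  assumes "GDERIV f x :> D"
  shows "gradient f x = D"
  unfolding gradient_def
proof (rule the_equality)
  fix E assume "GDERIV f x :> E"
  then have "(\<lambda>h. h \<bullet> E) = (\<lambda>h. h \<bullet> D)"
    using assms has_derivative_unique unfolding gderiv_def by blast
  then have "\<forall>h. h \<bullet> E = h \<bullet> D"
    by (simp add: fun_eq_iff)
  then show "E = D"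
    by (simp add: vector_eq_ldot)
qed (fact assms)

lemma hessian_eqI:
  assumes "(gradient f has_derivative (\<lambda>h. H *v h)) (at x)"
  shows "hessian f x = H"
  unfolding hessian_def jacobian_def
  by (simp flip: frechet_derivative_at[OF assms])

end

theory Submission
  imports Defs
begin

text \<open>At an equilibrium \<open>x\<close> put \<open>w\<^sub>i = \<zeta>\<^sub>i \<rho>\<^sub>i powr (- \<alpha> - 1)\<close>; then \<open>\<Sum> w\<^sub>i (x - p\<^sub>i) = 0\<close>, so \<open>x\<close> is
  determined by \<open>p = ln (w\<^sub>2 / w\<^sub>3)\<close>, \<open>q = ln (w\<^sub>3 / w\<^sub>1)\<close>, \<open>r = ln (w\<^sub>1 / w\<^sub>2)\<close>, with \<open>p + q + r = 0\<close>. In these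
  coordinates \<open>\<rho>\<^sub>1\<close> is proportional to \<open>w\<^sub>2 w\<^sub>3 exp (L\<^sub>1 p)\<close>, where \<open>L\<^sub>1\<close> is the logarithm of a cosh plus a
  constant, and cyclically. With \<open>\<delta> = \<alpha> / (\<alpha> + 1)\<close> the equations separate:
  \<open>L\<^sub>1 p - \<delta> p = L\<^sub>3 r + \<delta> r + c\<close> and \<open>L\<^sub>1 p + \<delta> p = L\<^sub>2 q - \<delta> q + d\<close>.
  Both sides of the first equation are V-shaped, so it describes two graphs, over \<open>r\<close> or over \<open>p\<close>. Along
  each of them the second equation has a derivative whose sign is that of
  \<open>F = l\<^sub>1 l\<^sub>2 + l\<^sub>2 l\<^sub>3 + l\<^sub>1 l\<^sub>3 + \<delta>\<^sup>2\<close>, \<open>l\<^sub>i = L\<^sub>i'\<close>, and \<open>F = 0\<close> makes the Hessian singular. Along a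
  graph \<open>F\<close> has no local minimum with a negative value, so that \<open>F\<close> changes sign at most twice and each
  graph carries at most three nondegenerate equilibria. For collinear charges the equilibria are counted
  directly.\<close>

section \<open>The second variation\<close>

text \<open>The decisive computation: the left-hand side, \<open>2 w \<Psi>'\<close> for the function \<open>\<Psi>\<close> below, collapses to
  \<open>(1 + \<beta>\<^sup>2) (m\<^sub>1 + m\<^sub>3) F - (3 + \<alpha>\<^sup>2 + \<beta>\<^sup>2 + \<kappa>\<^sup>2) Q\<close> with a positive definite quadratic form \<open>Q\<close>.\<close>

lemma second_variation_neg:
  fixes m1 m2 m3 \<alpha> \<beta> \<kappa> u w :: real
  assumes m: "m1 > 0" "m2 > 0" "m3 > 0"
    and uw: "u + w = (m1 + m3) * \<beta>"
    and crit: "u * (\<alpha> - \<beta>) + w * (\<kappa> - \<beta>) = 0"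
    and w: "w \<noteq> 0"
    and F: "(m2 + m3) * \<alpha> * w + (m1 + m2) * \<kappa> * u - u * w < 0"
  shows "(m2 + m3) * (m1 + m3) * (1 - \<alpha> * \<beta>) * w * (\<alpha> - \<beta>)
    + (m1 + m3) * (m1 + m2) * (1 - \<beta> * \<kappa>) * u * (\<kappa> - \<beta>)
    + u * (1 + \<alpha>\<^sup>2) * (m3 * w - m2 * (u + w) - m1 * u)
    - (u + w) * (1 + \<beta>\<^sup>2) * (m1 * u + m2 * (u + w) + m3 * w)
    + w * (1 + \<kappa>\<^sup>2) * (m1 * u - m2 * (u + w) - m3 * w) < 0" (is "?Z < 0")
proof -
  \<comment> \<open>\<open>crit\<close> makes (\<alpha> - \<beta>, \<kappa> - \<beta>) a multiple of
    (- w, u). With \<open>s\<close> for the factor, the equations among the hypotheses are solved,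
    and an identity in free variables remains.\<close>
  define s where "s = (\<beta> - \<alpha>) / w"
  have ws: "w * s = \<beta> - \<alpha>"
    using w by (simp add: s_def)
  then have \<alpha>: "\<alpha> = \<beta> - w * s"
    by simp
  have "w * (\<kappa> - \<beta>) = w * (u * s)"
    using crit ws by algebra
  then have \<kappa>: "\<kappa> = \<beta> + u * s"
    using w by simp
  have u: "u = (m1 + m3) * \<beta> - w"
    using uw by simp
  let ?F = "(m2 + m3) * \<alpha> * w + (m1 + m2) * \<kappa> * u - u * w"
  let ?Q = "m1 * u\<^sup>2 + m2 * (u + w)\<^sup>2 + m3 * w\<^sup>2"
  have "?Z = (1 + \<beta>\<^sup>2) * (m1 + m3) * ?F - (3 + \<alpha>\<^sup>2 + \<beta>\<^sup>2 + \<kappa>\<^sup>2) * ?Q"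
    unfolding \<alpha> \<kappa> u by algebra
  moreover have "(1 + \<beta>\<^sup>2) * (m1 + m3) * ?F < 0"
    using F m by (intro mult_pos_neg mult_pos_pos) (auto simp: add_pos_nonneg)
  moreover have "(3 + \<alpha>\<^sup>2 + \<beta>\<^sup>2 + \<kappa>\<^sup>2) * ?Q \<ge> 0"
    using m by (intro mult_nonneg_nonneg add_nonneg_nonneg) auto
  ultimately show ?thesis
    by linarith
qed

text \<open>For z_i = x_i + i y_i the hypotheses read z_i' = v_i (1 - z_i^2) / 2 for i = 2, 3 and
  z_1 z_2 + z_2 z_3 + z_1 z_3 = -1. Hence 1 - z_2^2 = - (z_2 + z_1) (z_2 + z_3), similarly for z_3,
  and z_2 + z_3 divides its own derivative. The ratio is the cotangent of the argument of z_2 + z_3,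
  so only the imaginary part of the logarithmic derivative enters.\<close>

lemma ratio_has_derivative:
  fixes x2 x3 y2 y3 :: "real \<Rightarrow> real"
  assumes x2: "(x2 has_real_derivative (1 - (x2 t)\<^sup>2 + (y2 t)\<^sup>2) / 2 * v2) (at t)"
    and x3: "(x3 has_real_derivative (1 - (x3 t)\<^sup>2 + (y3 t)\<^sup>2) / 2 * v3) (at t)"
    and y2: "(y2 has_real_derivative - x2 t * y2 t * v2) (at t)"
    and y3: "(y3 has_real_derivative - x3 t * y3 t * v3) (at t)"
    and C1: "X1 * (y2 t + y3 t) + x2 t * (Y1 + y3 t) + x3 t * (Y1 + y2 t) = 0"
    and C2: "Y1 * y2 t + y2 t * y3 t + Y1 * y3 t = 1 + (X1 * x2 t + x2 t * x3 t + X1 * x3 t)"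
    and pos: "y2 t > 0" "y3 t > 0"
  shows "((\<lambda>t. (x2 t + x3 t) / (y2 t + y3 t)) has_real_derivative
    (1 + ((x2 t + x3 t) / (y2 t + y3 t))\<^sup>2) / 2 * (y2 t * v2 + y3 t * v3 + Y1 * (v2 + v3))) (at t)"
proof -
  have nz: "y2 t + y3 t \<noteq> 0"
    using pos by linarith
  have D: "((\<lambda>t. (x2 t + x3 t) / (y2 t + y3 t)) has_real_derivative
      (((1 - (x2 t)\<^sup>2 + (y2 t)\<^sup>2) / 2 * v2 + (1 - (x3 t)\<^sup>2 + (y3 t)\<^sup>2) / 2 * v3) * (y2 t + y3 t)
        - (x2 t + x3 t) * (- x2 t * y2 t * v2 + - x3 t * y3 t * v3))
      / ((y2 t + y3 t) * (y2 t + y3 t))) (at t)"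
    by (intro DERIV_divide DERIV_add assms nz)
  have half: "(1 - p\<^sup>2 + r\<^sup>2) * (r + r') + (p + p') * (2 * p * r) = ((r + r')\<^sup>2 + (p + p')\<^sup>2) * (Y1 + r)"
    if "X1 * (r + r') + p * (Y1 + r') + p' * (Y1 + r) = 0"
      "Y1 * r + r * r' + Y1 * r' = 1 + (X1 * p + p * p' + X1 * p')" for p p' r r'
  proof -
    \<comment> \<open>This line and the next are the real and imaginary parts of 1 - z^2 = - (z +
      z_1) (z + z') for z = p + i r.\<close>
    have 1: "1 - p\<^sup>2 + r\<^sup>2 = (r + r') * (Y1 + r) - (p + p') * (X1 + p)"
      using that(2) by (simp add: algebra_simps power2_eq_square)
    have 2: "2 * p * r = (X1 + p) * (r + r') + (p + p') * (Y1 + r)"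
      using that(1) by (simp add: algebra_simps)
    show ?thesis
      unfolding 1 2 by (simp add: algebra_simps power2_eq_square)
  qed
  let ?d2 = "(1 - (x2 t)\<^sup>2 + (y2 t)\<^sup>2) * (y2 t + y3 t) + (x2 t + x3 t) * (2 * x2 t * y2 t)"
  let ?d3 = "(1 - (x3 t)\<^sup>2 + (y3 t)\<^sup>2) * (y3 t + y2 t) + (x3 t + x2 t) * (2 * x3 t * y3 t)"
  have "((1 - (x2 t)\<^sup>2 + (y2 t)\<^sup>2) / 2 * v2 + (1 - (x3 t)\<^sup>2 + (y3 t)\<^sup>2) / 2 * v3) * (y2 t + y3 t)
        - (x2 t + x3 t) * (- x2 t * y2 t * v2 + - x3 t * y3 t * v3) = ?d2 * v2 / 2 + ?d3 * v3 / 2"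
    by (simp add: field_simps)
  also have "?d2 = ((y2 t + y3 t)\<^sup>2 + (x2 t + x3 t)\<^sup>2) * (Y1 + y2 t)"
    by (rule half) (use C1 C2 in auto)
  also have "?d3 = ((y2 t + y3 t)\<^sup>2 + (x2 t + x3 t)\<^sup>2) * (Y1 + y3 t)"
    by (subst half) (use C1 C2 in \<open>auto simp: algebra_simps\<close>)
  also have "((y2 t + y3 t)\<^sup>2 + (x2 t + x3 t)\<^sup>2) * (Y1 + y2 t) * v2 / 2
      + ((y2 t + y3 t)\<^sup>2 + (x2 t + x3 t)\<^sup>2) * (Y1 + y3 t) * v3 / 2
    = ((y2 t + y3 t)\<^sup>2 + (x2 t + x3 t)\<^sup>2) * ((y2 t * v2 + y3 t * v3 + Y1 * (v2 + v3)) / 2)"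
    by (simp add: algebra_simps add_divide_distrib)
  also have "\<dots> / ((y2 t + y3 t) * (y2 t + y3 t))
    = ((y2 t + y3 t)\<^sup>2 + (x2 t + x3 t)\<^sup>2) / (y2 t + y3 t)\<^sup>2 * ((y2 t * v2 + y3 t * v3 + Y1 * (v2 + v3)) / 2)"
    by (simp only: power2_eq_square times_divide_eq_left)
  also have "((y2 t + y3 t)\<^sup>2 + (x2 t + x3 t)\<^sup>2) / (y2 t + y3 t)\<^sup>2
    = 1 + ((x2 t + x3 t) / (y2 t + y3 t))\<^sup>2"
    using nz by (subst power_divide) (simp add: add_divide_distrib)
  finally have E: "(((1 - (x2 t)\<^sup>2 + (y2 t)\<^sup>2) / 2 * v2 + (1 - (x3 t)\<^sup>2 + (y3 t)\<^sup>2) / 2 * v3) * (y2 t + y3 t)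
        - (x2 t + x3 t) * (- x2 t * y2 t * v2 + - x3 t * y3 t * v3))
      / ((y2 t + y3 t) * (y2 t + y3 t))
    = (1 + ((x2 t + x3 t) / (y2 t + y3 t))\<^sup>2) * ((y2 t * v2 + y3 t * v3 + Y1 * (v2 + v3)) / 2)" .
  show ?thesis
    using D unfolding E by simp
qed

text \<open>Here \<open>x\<^sub>i\<close> and \<open>y\<^sub>i\<close> are the values of \<open>l\<^sub>i\<close> and \<open>m\<^sub>i\<close> along a curve whose coordinates move with
  velocities \<open>v\<^sub>i\<close>; the last line of assumptions says that it is a level curve of the first equation.
  The function \<open>\<Psi>\<close> is \<open>F'\<close> up to a positive factor.\<close>

locale moving_triple =
  fixes x1 x2 x3 y1 y2 y3 :: "real \<Rightarrow> real" and v1 v2 v3 t \<delta> :: real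
  assumes x1: "(x1 has_real_derivative (1 - (x1 t)\<^sup>2 + (y1 t)\<^sup>2) / 2 * v1) (at t)"
    and x2: "(x2 has_real_derivative (1 - (x2 t)\<^sup>2 + (y2 t)\<^sup>2) / 2 * v2) (at t)"
    and x3: "(x3 has_real_derivative (1 - (x3 t)\<^sup>2 + (y3 t)\<^sup>2) / 2 * v3) (at t)"
    and y1: "(y1 has_real_derivative - x1 t * y1 t * v1) (at t)"
    and y2: "(y2 has_real_derivative - x2 t * y2 t * v2) (at t)"
    and y3: "(y3 has_real_derivative - x3 t * y3 t * v3) (at t)"
    and C1: "x1 t * (y2 t + y3 t) + x2 t * (y1 t + y3 t) + x3 t * (y1 t + y2 t) = 0"
    and C2: "y1 t * y2 t + y2 t * y3 t + y1 t * y3 t = 1 + (x1 t * x2 t + x2 t * x3 t + x1 t * x3 t)"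
    and pos: "y1 t > 0" "y2 t > 0" "y3 t > 0"
    and w: "x1 t - \<delta> \<noteq> 0"
    and v: "v1 = (x3 t + \<delta>) / (x1 t - \<delta>)" "v2 = - (v1 + v3)" "v3 = 1"
begin

text \<open>The cotangents of the arguments of the pairwise sums of z_i = x_i + i y_i; in these
  variables the velocities of the x_i factor.\<close>

definition \<alpha> :: "real \<Rightarrow> real" where "\<alpha> s = (x2 s + x3 s) / (y2 s + y3 s)"
definition \<beta> :: "real \<Rightarrow> real" where "\<beta> s = (x1 s + x3 s) / (y1 s + y3 s)"
definition \<kappa> :: "real \<Rightarrow> real" where "\<kappa> s = (x1 s + x2 s) / (y1 s + y2 s)"
definition \<Psi> :: "real \<Rightarrow> real" where
  "\<Psi> s = (x3 s + \<delta>) * (\<alpha> s - \<beta> s) + (x1 s - \<delta>) * (\<kappa> s - \<beta> s)"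
definition F :: "real \<Rightarrow> real" where "F s = x1 s * x2 s + x2 s * x3 s + x1 s * x3 s + \<delta>\<^sup>2"

lemma numerators:
  "x2 t + x3 t = (y2 t + y3 t) * \<alpha> t" "x1 t + x3 t = (y1 t + y3 t) * \<beta> t"
  "x1 t + x2 t = (y1 t + y2 t) * \<kappa> t"
  using pos by (auto simp: \<alpha>_def \<beta>_def \<kappa>_def field_simps)

lemma v1_w: "v1 * (x1 t - \<delta>) = x3 t + \<delta>"
  using w by (simp add: v)

text \<open>Real parts of 1 - z_1^2 = - (z_1 + z_2) (z_1 + z_3) and its analogues, each sum being
  its imaginary part times (cotangent + i).\<close>

lemma rates:
  "1 - (x1 t)\<^sup>2 + (y1 t)\<^sup>2 = (y1 t + y3 t) * (y1 t + y2 t) * (1 - \<beta> t * \<kappa> t)"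
  "1 - (x2 t)\<^sup>2 + (y2 t)\<^sup>2 = (y2 t + y3 t) * (y1 t + y2 t) * (1 - \<alpha> t * \<kappa> t)"
  "1 - (x3 t)\<^sup>2 + (y3 t)\<^sup>2 = (y2 t + y3 t) * (y1 t + y3 t) * (1 - \<alpha> t * \<beta> t)"
proof -
  have "1 - (x1 t)\<^sup>2 + (y1 t)\<^sup>2 = (y1 t + y3 t) * (y1 t + y2 t) - (x1 t + x3 t) * (x1 t + x2 t)"
    "1 - (x2 t)\<^sup>2 + (y2 t)\<^sup>2 = (y2 t + y3 t) * (y1 t + y2 t) - (x2 t + x3 t) * (x1 t + x2 t)"
    "1 - (x3 t)\<^sup>2 + (y3 t)\<^sup>2 = (y2 t + y3 t) * (y1 t + y3 t) - (x2 t + x3 t) * (x1 t + x3 t)"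
    using C2 by (simp_all add: algebra_simps power2_eq_square)
  then show "1 - (x1 t)\<^sup>2 + (y1 t)\<^sup>2 = (y1 t + y3 t) * (y1 t + y2 t) * (1 - \<beta> t * \<kappa> t)"
    "1 - (x2 t)\<^sup>2 + (y2 t)\<^sup>2 = (y2 t + y3 t) * (y1 t + y2 t) * (1 - \<alpha> t * \<kappa> t)"
    "1 - (x3 t)\<^sup>2 + (y3 t)\<^sup>2 = (y2 t + y3 t) * (y1 t + y3 t) * (1 - \<alpha> t * \<beta> t)"
    unfolding numerators by (simp_all add: algebra_simps)
qed

text \<open>Every term contains the product of all three sums y_i + y_j. The terms with \<alpha>
  \<beta> \<kappa> cancel because the velocities add up to zero.\<close>

lemma F_derivative:
  "(F has_real_derivative (y2 t + y3 t) * (y1 t + y3 t) * (y1 t + y2 t) / 2 * \<Psi> t / (x1 t - \<delta>)) (at t)"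
proof -
  let ?D1 = "(1 - (x1 t)\<^sup>2 + (y1 t)\<^sup>2) / 2 * v1"
  let ?D2 = "(1 - (x2 t)\<^sup>2 + (y2 t)\<^sup>2) / 2 * v2"
  let ?D3 = "(1 - (x3 t)\<^sup>2 + (y3 t)\<^sup>2) / 2 * v3"
  have "(F has_real_derivative (x2 t + x3 t) * d1 + (x1 t + x3 t) * d2 + (x1 t + x2 t) * d3) (at t)"
    if "(x1 has_real_derivative d1) (at t)" "(x2 has_real_derivative d2) (at t)"
      "(x3 has_real_derivative d3) (at t)" for d1 d2 d3
    unfolding F_def by (rule derivative_eq_intros that refl)+ (simp add: algebra_simps)
  from this[OF x1 x2 x3]
  have "(F has_real_derivative (x2 t + x3 t) * ?D1 + (x1 t + x3 t) * ?D2 + (x1 t + x2 t) * ?D3) (at t)" .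
  also have "(x2 t + x3 t) * ?D1 + (x1 t + x3 t) * ?D2 + (x1 t + x2 t) * ?D3
    = (y2 t + y3 t) * (y1 t + y3 t) * (y1 t + y2 t) / 2 * (v1 * (\<alpha> t - \<beta> t) + (\<kappa> t - \<beta> t))"
    unfolding rates numerators v(2,3) by (simp add: field_simps)
  also have "v1 * (\<alpha> t - \<beta> t) + (\<kappa> t - \<beta> t) = \<Psi> t / (x1 t - \<delta>)"
  proof -
    have "\<Psi> t = (x1 t - \<delta>) * (v1 * (\<alpha> t - \<beta> t) + (\<kappa> t - \<beta> t))"
      unfolding \<Psi>_def v1_w[symmetric] by (simp add: algebra_simps)
    then show ?thesis
      using w by simp
  qed
  finally show ?thesis
    by simp
qed

text \<open>Serves to exclude negative minima of \<open>F\<close>: if \<open>x1 t - \<delta>\<close>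
  is positive, F' has the sign of \<Psi>, and where \<open>F\<close> is negative \<Psi> can vanish
  only while decreasing, as at a maximum.\<close>

lemma \<Psi>_derivative:
  obtains D where "(\<Psi> has_real_derivative D) (at t)" "\<Psi> t = 0 \<Longrightarrow> F t < 0 \<Longrightarrow> D * (x1 t - \<delta>) < 0"
proof
  let ?a = "(1 + (\<alpha> t)\<^sup>2) / 2 * (y2 t * v2 + y3 t * v3 + y1 t * (v2 + v3))"
  let ?b = "(1 + (\<beta> t)\<^sup>2) / 2 * (y1 t * v1 + y3 t * v3 + y2 t * (v1 + v3))"
  let ?c = "(1 + (\<kappa> t)\<^sup>2) / 2 * (y1 t * v1 + y2 t * v2 + y3 t * (v1 + v2))"
  let ?D1 = "(1 - (x1 t)\<^sup>2 + (y1 t)\<^sup>2) / 2 * v1"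
  let ?D3 = "(1 - (x3 t)\<^sup>2 + (y3 t)\<^sup>2) / 2 * v3"
  let ?D = "?D3 * (\<alpha> t - \<beta> t) + (x3 t + \<delta>) * (?a - ?b) + (?D1 * (\<kappa> t - \<beta> t) + (x1 t - \<delta>) * (?c - ?b))"
  have a: "(\<alpha> has_real_derivative ?a) (at t)"
    unfolding \<alpha>_def by (rule ratio_has_derivative[OF x2 x3 y2 y3, of "x1 t"]) (use C1 C2 pos in auto)
  have b: "(\<beta> has_real_derivative ?b) (at t)"
    unfolding \<beta>_def by (rule ratio_has_derivative[OF x1 x3 y1 y3, of "x2 t"]) (use C1 C2 pos in \<open>auto simp: algebra_simps\<close>)
  have c: "(\<kappa> has_real_derivative ?c) (at t)"
    unfolding \<kappa>_def by (rule ratio_has_derivative[OF x1 x2 y1 y2, of "x3 t"]) (use C1 C2 pos in \<open>auto simp: algebra_simps\<close>)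
  show "(\<Psi> has_real_derivative ?D) (at t)"
    unfolding \<Psi>_def by (rule derivative_eq_intros x1 x3 a b c refl)+ (simp add: algebra_simps)
  assume "\<Psi> t = 0" "F t < 0"
  define u w where "u = x3 t + \<delta>" and "w = x1 t - \<delta>"
  have u: "u = v1 * w"
    using v1_w by (simp add: u_def w_def)
  \<comment> \<open>Substituting x1 = w + \<delta> and x3 = u - \<delta> turns \<open>F\<close> into
    the expression of \<open>second_variation_neg\<close>.\<close>
  have F: "(y2 t + y3 t) * \<alpha> t * w + (y1 t + y2 t) * \<kappa> t * u - u * w < 0"
    using \<open>F t < 0\<close> unfolding numerators[symmetric] F_def u_def w_def
    by (simp add: algebra_simps power2_eq_square)
  have "2 * (?D * w) = (y2 t + y3 t) * (y1 t + y3 t) * (1 - \<alpha> t * \<beta> t) * w * (\<alpha> t - \<beta> t)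
    + (y1 t + y3 t) * (y1 t + y2 t) * (1 - \<beta> t * \<kappa> t) * u * (\<kappa> t - \<beta> t)
    + u * (1 + (\<alpha> t)\<^sup>2) * (y3 t * w - y2 t * (u + w) - y1 t * u)
    - (u + w) * (1 + (\<beta> t)\<^sup>2) * (y1 t * u + y2 t * (u + w) + y3 t * w)
    + w * (1 + (\<kappa> t)\<^sup>2) * (y1 t * u - y2 t * (u + w) - y3 t * w)"
    unfolding rates v(2,3) u_def[symmetric] w_def[symmetric] u
    by (simp add: field_simps power2_eq_square)
  also have "\<dots> < 0"
    by (rule second_variation_neg[OF pos _ _ _ F])
      (use numerators \<open>\<Psi> t = 0\<close> w in \<open>auto simp: u_def w_def \<Psi>_def\<close>)
  finally have "2 * (?D * w) < 0" .
  moreover have "z < 0" if "2 * z < 0" for z :: real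
    using that by simp
  ultimately show "?D * (x1 t - \<delta>) < 0"
    unfolding w_def by blast
qed

end

section \<open>Calculus on the line\<close>

text \<open>At \<open>p\<close> the derivative of \<open>f\<close> may vanish, and the implicit
  function theorem gives nothing. Continuity of \<phi> there comes from monotonicity;
  differentiability is claimed only above \<open>p\<close>.\<close>

lemma implicit_graph:
  fixes f f' h h' :: "real \<Rightarrow> real"
  assumes f: "\<And>s. (f has_real_derivative f' s) (at s)"
    and f'_pos: "\<And>s. p < s \<Longrightarrow> f' s > 0"
    and f_top: "filterlim f at_top at_top"
    and h: "\<And>r. (h has_real_derivative h' r) (at r)"
    and h_ge: "\<And>r. h r \<ge> f p"
  obtains \<phi> where "\<And>r. \<phi> r \<ge> p" "\<And>r. f (\<phi> r) = h r" "\<And>r. isCont \<phi> r"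
    "\<And>r. p < \<phi> r \<Longrightarrow> (\<phi> has_real_derivative h' r / f' (\<phi> r)) (at r)"
proof -
  \<comment> \<open>Left of \<open>p\<close> the function is replaced by a line of slope one. This
    makes \<open>g\<close> strictly increasing on the whole line, hence injective with a continuous
    inverse.\<close>
  define g where "g s = f (max s p) + min (s - p) 0" for s
  have f_cont: "isCont f s" for s
    using f by (rule DERIV_isCont)
  have f_less: "f s < f s'" if "p \<le> s" "s < s'" for s s'
    by (rule DERIV_pos_imp_increasing_open[OF \<open>s < s'\<close>])
      (use that f f'_pos f_cont in \<open>auto intro!: continuous_at_imp_continuous_on exI[of _ "f' _"]\<close>)
  have g_less: "g s < g s'" if "s < s'" for s s'
  proof (cases "s' \<le> p")
    case True
    then show ?thesis
      using that by (simp add: g_def max_def min_def)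
  next
    case False
    then show ?thesis
      using that f_less[of "max s p" s'] by (cases "s \<le> p") (auto simp: g_def max_def min_def)
  qed
  then have "inj g"
    by (intro linorder_injI) (metis less_irrefl)
  then have inv_g: "inv g (g s) = s" for s
    by simp
  have g_cont: "isCont g s" for s
  proof -
    have "continuous_on UNIV f"
      using f_cont by (simp add: continuous_at_imp_continuous_on)
    then have "continuous_on UNIV (\<lambda>s. f (max s p))"
      by (rule continuous_on_compose2) (auto intro!: continuous_intros)
    then have "continuous_on UNIV g"
      unfolding g_def by (intro continuous_intros)
    then show ?thesis
      by (simp add: continuous_on_eq_continuous_at)
  qed
  have inv_g_cont: "isCont (inv g) (g s)" for s
    by (rule isCont_inverse_function[of 1]) (use inv_g g_cont in auto)
  have root: "\<exists>s\<ge>p. f s = y \<and> inv g y = s" if y: "y \<ge> f p" for y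
  proof -
    obtain b where b: "b \<ge> p" "f b \<ge> y"
      using f_top unfolding filterlim_at_top eventually_at_top_linorder
      by (metis linorder_le_cases order_refl)
    then obtain s where s: "p \<le> s" "f s = y"
      using IVT[of f p y b] y f_cont by auto
    then have "g s = y"
      by (simp add: g_def max_def min_def)
    then show ?thesis
      using s inv_g by auto
  qed
  define \<phi> where "\<phi> r = inv g (h r)" for r
  have \<phi>: "\<phi> r \<ge> p" "f (\<phi> r) = h r" "g (\<phi> r) = h r" for r
    using root[OF h_ge[of r]] by (auto simp: \<phi>_def g_def max_def min_def)
  have \<phi>_cont: "isCont \<phi> r" for r
    unfolding \<phi>_def
    by (rule isCont_o2[OF DERIV_isCont[OF h]]) (metis inv_g_cont \<phi>(3))
  have "(\<phi> has_real_derivative h' r / f' (\<phi> r)) (at r)" if r: "p < \<phi> r" for r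
  proof -
    have "(inv g has_real_derivative inverse (f' (\<phi> r))) (at (h r))"
    proof (rule DERIV_inverse_function)
      show "(f has_real_derivative f' (\<phi> r)) (at (inv g (h r)))"
        using f by (simp add: \<phi>_def)
      show "f' (\<phi> r) \<noteq> 0"
        using f'_pos[OF r] by simp
      show "f p < h r" "h r < h r + 1"
        using f_less[OF order_refl r] \<phi>(2)[of r] by auto
      show "f (inv g y) = y" if "f p < y" for y
        using root[of y] that by auto
      show "isCont (inv g) (h r)"
        using inv_g_cont[of "\<phi> r"] \<phi>(3) by simp
    qed
    moreover have "\<phi> = (\<lambda>r. inv g (h r))"
      by (simp add: \<phi>_def fun_eq_iff)
    ultimately show ?thesis
      using DERIV_chain2[OF _ h, of "inv g" "inverse (f' (\<phi> r))"] by (simp add: field_simps)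
  qed
  then show thesis
    using that \<phi> \<phi>_cont by blast
qed

text \<open>The point \<open>e\<close> stands for a possible corner of \<open>f\<close>, where
  continuity glues two monotone pieces.\<close>

lemma nonincreasing_except_point:
  fixes f :: "real \<Rightarrow> real"
  assumes "a \<le> b" and cont: "continuous_on {a..b} f"
    and D: "\<And>x. a < x \<Longrightarrow> x < b \<Longrightarrow> x \<noteq> e \<Longrightarrow> \<exists>D. (f has_real_derivative D) (at x) \<and> D \<le> 0"
  shows "f b \<le> f a"
proof (cases "a < e \<and> e < b")
  case True
  have "f e \<le> f a"
    by (rule DERIV_nonpos_imp_decreasing_open)
      (use True D in \<open>auto intro!: continuous_on_subset[OF cont]\<close>)
  moreover have "f b \<le> f e"
    by (rule DERIV_nonpos_imp_decreasing_open)
      (use True D in \<open>auto intro!: continuous_on_subset[OF cont]\<close>)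
  ultimately show ?thesis
    by simp
next
  case False
  then show ?thesis
    by (intro DERIV_nonpos_imp_decreasing_open[OF assms(1) _ cont] D) auto
qed

text \<open>As \<open>f' a \<noteq> 0\<close>, the function becomes negative right after \<open>a\<close> and cannot return to zero.\<close>

lemma equal_zeros_of_nonincreasing:
  fixes f f' :: "real \<Rightarrow> real"
  assumes cont: "\<And>x. isCont f x"
    and D: "\<And>x. x \<noteq> e \<Longrightarrow> (f has_real_derivative f' x) (at x)"
    and "a \<le> b" "f a = 0" "f b = 0" "a \<noteq> e" "f' a \<noteq> 0"
    and le: "\<And>x. a \<le> x \<Longrightarrow> x \<le> b \<Longrightarrow> x \<noteq> e \<Longrightarrow> f' x \<le> 0"
  shows "a = b"
proof (rule ccontr)
  assume "a \<noteq> b"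
  with \<open>a \<le> b\<close> have "a < b"
    by simp
  have "f' a < 0"
    using le[of a] assms by force
  then obtain d where d: "d > 0" "\<And>h. 0 < h \<Longrightarrow> h < d \<Longrightarrow> f (a + h) < f a"
    using DERIV_neg_dec_right[OF D[OF \<open>a \<noteq> e\<close>]] by blast
  define c where "c = a + min (d / 2) (b - a)"
  have c: "a < c" "c \<le> b"
    using \<open>a < b\<close> d(1) by (auto simp: c_def min_def)
  have "f c < 0"
    using d \<open>a < b\<close> \<open>f a = 0\<close> unfolding c_def by (simp add: min_def)
  moreover have "f b \<le> f c"
  proof (rule nonincreasing_except_point[where f = f and e = e])
    show "continuous_on {c..b} f"
      using cont by (simp add: continuous_at_imp_continuous_on)
    show "\<exists>D. (f has_real_derivative D) (at x) \<and> D \<le> 0" if "c < x" "x < b" "x \<noteq> e" for x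
      using D[of x] le[of x] that c by auto
  qed (use c in auto)
  ultimately show False
    using \<open>f b = 0\<close> by simp
qed

section \<open>Counting solutions of the separated system\<close>

text \<open>The model is \<open>L s = ln (cosh s + cos A)\<close>, for which \<open>l s + \<i> m s = tanh ((s + \<i> A) / 2)\<close>. For the angles of a
  triangle and \<open>p + q + r = 0\<close>, the addition theorem of tanh gives \<open>t\<^sub>1 t\<^sub>2 + t\<^sub>2 t\<^sub>3 + t\<^sub>1 t\<^sub>3 = - 1\<close> for the three
  values; the assumptions of the locale \<open>log_kernel_triple\<close> are its imaginary and real parts.\<close>

locale log_kernel =
  fixes L l m :: "real \<Rightarrow> real"
  assumes L_deriv: "(L has_real_derivative l s) (at s)"
    and l_deriv: "(l has_real_derivative (1 - (l s)\<^sup>2 + (m s)\<^sup>2) / 2) (at s)"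
    and m_deriv: "(m has_real_derivative - l s * m s) (at s)"
    and m_pos: "m s > 0"
    and threshold: "\<bar>d\<bar> < 1 \<Longrightarrow> \<exists>p. \<forall>s. (s < p \<longrightarrow> l s < d) \<and> (p < s \<longrightarrow> d < l s)"
begin

lemma log_kernel_reflect: "log_kernel (\<lambda>s. L (- s)) (\<lambda>s. - l (- s)) (\<lambda>s. m (- s))"
proof
  fix s
  have neg: "(uminus has_real_derivative - 1) (at s)"
    by (auto intro!: derivative_eq_intros)
  show "((\<lambda>s. L (- s)) has_real_derivative - l (- s)) (at s)"
    using DERIV_chain2[OF L_deriv neg] by simp
  show "((\<lambda>s. - l (- s)) has_real_derivative (1 - (- l (- s))\<^sup>2 + (m (- s))\<^sup>2) / 2) (at s)"
    using DERIV_minus[OF DERIV_chain2[OF l_deriv neg]] by simp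
  show "((\<lambda>s. m (- s)) has_real_derivative - (- l (- s)) * m (- s)) (at s)"
    using DERIV_chain2[OF m_deriv neg] by simp
  show "m (- s) > 0"
    by (rule m_pos)
next
  fix d :: real
  assume "\<bar>d\<bar> < 1"
  then obtain p where p: "\<And>s. s < p \<Longrightarrow> l s < - d" "\<And>s. p < s \<Longrightarrow> - d < l s"
    using threshold[of "- d"] by auto
  show "\<exists>p. \<forall>s. (s < p \<longrightarrow> - l (- s) < d) \<and> (p < s \<longrightarrow> d < - l (- s))"
    using p by (intro exI[of _ "- p"]) (auto simp: less_minus_iff minus_less_iff)
qed

lemma threshold_eq:
  assumes "\<And>s. s < p \<Longrightarrow> l s < d" "\<And>s. p < s \<Longrightarrow> d < l s"
  shows "l p = d"
proof -
  have lim: "(l \<longlongrightarrow> l p) (at p within S)" for S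
    using isContD[OF DERIV_isCont[OF l_deriv[of p]]] by (rule tendsto_within_subset) simp
  have "l p \<ge> d"
    by (rule tendsto_lowerbound[OF lim[of "{p<..}"]])
      (use assms(2) in \<open>auto simp: eventually_at_filter intro!: always_eventually less_imp_le\<close>)
  moreover have "l p \<le> d"
    by (rule tendsto_upperbound[OF lim[of "{..<p}"]])
      (use assms(1) in \<open>auto simp: eventually_at_filter intro!: always_eventually less_imp_le\<close>)
  ultimately show ?thesis
    by simp
qed

lemma tilted_at_top:
  assumes "\<bar>d\<bar> < 1"
  shows "filterlim (\<lambda>s. L s - d * s) at_top at_top"
proof -
  \<comment> \<open>The midpoint of \<open>d\<close> and 1: beyond some point the tilted function
    has slope at least \<open>e - d > 0\<close>.\<close>
  define e where "e = (1 + d) / 2"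
  have e: "\<bar>e\<bar> < 1" "d < e"
    using assms by (auto simp: e_def)
  then obtain p where p: "\<And>s. p < s \<Longrightarrow> e < l s"
    using threshold[of e] by auto
  have "L p - e * p + (e - d) * s \<le> L s - d * s" if "s \<ge> p" for s
  proof -
    have "L p - e * p \<le> L s - e * s"
    proof (rule DERIV_nonneg_imp_increasing_open[OF that])
      show "\<exists>y. ((\<lambda>s. L s - e * s) has_real_derivative y) (at x) \<and> 0 \<le> y" if "p < x" "x < s" for x
        using p[OF \<open>p < x\<close>] by (intro exI[of _ "l x - e"]) (auto intro!: derivative_eq_intros L_deriv)
      show "continuous_on {p..s} (\<lambda>s. L s - e * s)"
        by (intro continuous_intros continuous_at_imp_continuous_on ballI DERIV_isCont[OF L_deriv])
    qed
    then show ?thesis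
      by (simp add: algebra_simps)
  qed
  then have "eventually (\<lambda>s. L p - e * p + (e - d) * s \<le> L s - d * s) at_top"
    by (auto simp: eventually_at_top_linorder)
  moreover have "filterlim (\<lambda>s. L p - e * p + (e - d) * s) at_top at_top"
    using e(2) by (intro filterlim_tendsto_add_at_top[OF tendsto_const]
      filterlim_tendsto_pos_mult_at_top[OF tendsto_const _ filterlim_ident]) auto
  ultimately show ?thesis
    by (rule filterlim_at_top_mono[rotated])
qed

end

section \<open>Triples of kernels and their symmetries\<close>

locale log_kernel_triple =
  K1: log_kernel L1 l1 m1 + K2: log_kernel L2 l2 m2 + K3: log_kernel L3 l3 m3
  for L1 l1 m1 L2 l2 m2 L3 l3 m3 +
  assumes mixed: "p + q + r = 0 \<Longrightarrow>
      l1 p * (m2 q + m3 r) + l2 q * (m1 p + m3 r) + l3 r * (m1 p + m2 q) = 0"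
    and pairs: "p + q + r = 0 \<Longrightarrow>
      m1 p * m2 q + m2 q * m3 r + m1 p * m3 r = 1 + (l1 p * l2 q + l2 q * l3 r + l1 p * l3 r)"
begin

text \<open>The Jacobian determinant in (p, r) of the two separated equations, each written as left
  side minus right side.\<close>

definition critical_sum :: "real \<Rightarrow> real \<Rightarrow> real \<Rightarrow> real" where
  "critical_sum \<delta> p r = l1 p * l2 (- p - r) + l2 (- p - r) * l3 r + l1 p * l3 r + \<delta>\<^sup>2"

text \<open>Exchanges the two sides of a threshold, so that only branches to the right of one need
  study. The identity \<open>mixed\<close> is odd and \<open>pairs\<close> is even in the
  \<open>l\<close> values.\<close>

lemma triple_reflect:
  "log_kernel_triple (\<lambda>s. L1 (- s)) (\<lambda>s. - l1 (- s)) (\<lambda>s. m1 (- s))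
    (\<lambda>s. L2 (- s)) (\<lambda>s. - l2 (- s)) (\<lambda>s. m2 (- s))
    (\<lambda>s. L3 (- s)) (\<lambda>s. - l3 (- s)) (\<lambda>s. m3 (- s))"
proof (intro log_kernel_triple.intro log_kernel_triple_axioms.intro
    K1.log_kernel_reflect K2.log_kernel_reflect K3.log_kernel_reflect)
  fix p q r :: real
  assume "p + q + r = 0"
  then have "- p + - q + - r = 0"
    by simp
  from mixed[OF this] pairs[OF this]
  show "- l1 (- p) * (m2 (- q) + m3 (- r)) + - l2 (- q) * (m1 (- p) + m3 (- r))
      + - l3 (- r) * (m1 (- p) + m2 (- q)) = 0"
    and "m1 (- p) * m2 (- q) + m2 (- q) * m3 (- r) + m1 (- p) * m3 (- r) =
      1 + (- l1 (- p) * - l2 (- q) + - l2 (- q) * - l3 (- r) + - l1 (- p) * - l3 (- r))"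
    by (auto simp: algebra_simps)
qed

text \<open>Exchanges the roles of \<open>p\<close> and \<open>r\<close>, for the case in which the
  level curve is a graph over \<open>p\<close>.\<close>

lemma triple_swap:
  "log_kernel_triple L3 l3 m3 L2 l2 m2 L1 l1 m1"
proof (intro log_kernel_triple.intro log_kernel_triple_axioms.intro
    K1.log_kernel_axioms K2.log_kernel_axioms K3.log_kernel_axioms)
  fix p q r :: real
  assume "p + q + r = 0"
  then have "r + q + p = 0"
    by simp
  from mixed[OF this] pairs[OF this]
  show "l3 p * (m2 q + m1 r) + l2 q * (m3 p + m1 r) + l1 r * (m3 p + m2 q) = 0"
    and "m3 p * m2 q + m2 q * m1 r + m3 p * m1 r = 1 + (l3 p * l2 q + l2 q * l1 r + l3 p * l1 r)"
    by (auto simp: algebra_simps)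
qed

end

text \<open>The first equation solved for \<open>p\<close> to the right of \<open>p0\<close>, where
  its left side increases. By \<open>level\<close> the right side never falls below the minimum of
  the left side, so this branch lies over every \<open>r\<close>.\<close>

locale upper_graph = log_kernel_triple +
  fixes \<delta> p0 c :: real and \<phi> :: "real \<Rightarrow> real"
  assumes \<delta>: "\<bar>\<delta>\<bar> < 1"
    and below_p0: "s < p0 \<Longrightarrow> l1 s < \<delta>"
    and above_p0: "p0 < s \<Longrightarrow> \<delta> < l1 s"
    and \<phi>_ge: "\<phi> r \<ge> p0"
    and \<phi>_eq: "L1 (\<phi> r) - \<delta> * \<phi> r = L3 r + \<delta> * r + c"
    and \<phi>_cont: "isCont \<phi> r"
    and \<phi>_deriv: "p0 < \<phi> r \<Longrightarrow> (\<phi> has_real_derivative (l3 r + \<delta>) / (l1 (\<phi> r) - \<delta>)) (at r)"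
    and level: "L3 r + \<delta> * r + c \<ge> L1 p0 - \<delta> * p0"
begin

lemma l1_p0: "l1 p0 = \<delta>"
  using below_p0 above_p0 by (rule K1.threshold_eq)

abbreviation \<psi> :: "real \<Rightarrow> real" where "\<psi> r \<equiv> - \<phi> r - r"

lemma moving:
  assumes "p0 < \<phi> t"
  shows "moving_triple (\<lambda>r. l1 (\<phi> r)) (\<lambda>r. l2 (\<psi> r)) l3 (\<lambda>r. m1 (\<phi> r)) (\<lambda>r. m2 (\<psi> r)) m3
    ((l3 t + \<delta>) / (l1 (\<phi> t) - \<delta>)) (- ((l3 t + \<delta>) / (l1 (\<phi> t) - \<delta>) + 1)) 1 t \<delta>"
proof -
  let ?v1 = "(l3 t + \<delta>) / (l1 (\<phi> t) - \<delta>)"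
  have \<psi>: "(\<psi> has_real_derivative - (?v1 + 1)) (at t)"
    using \<phi>_deriv[OF assms] by (auto intro!: derivative_eq_intros)
  have sum0: "\<phi> t + \<psi> t + t = 0"
    by simp
  show ?thesis
  proof
    show "l1 (\<phi> t) - \<delta> \<noteq> 0"
      using above_p0[OF assms] by simp
    show "((\<lambda>r. l1 (\<phi> r)) has_real_derivative (1 - (l1 (\<phi> t))\<^sup>2 + (m1 (\<phi> t))\<^sup>2) / 2 * ?v1) (at t)"
      "((\<lambda>r. m1 (\<phi> r)) has_real_derivative - l1 (\<phi> t) * m1 (\<phi> t) * ?v1) (at t)"
      by (rule DERIV_chain2[OF _ \<phi>_deriv[OF assms]] K1.l_deriv K1.m_deriv)+
    show "((\<lambda>r. l2 (\<psi> r)) has_real_derivative (1 - (l2 (\<psi> t))\<^sup>2 + (m2 (\<psi> t))\<^sup>2) / 2 * - (?v1 + 1)) (at t)"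
      "((\<lambda>r. m2 (\<psi> r)) has_real_derivative - l2 (\<psi> t) * m2 (\<psi> t) * - (?v1 + 1)) (at t)"
      by (rule DERIV_chain2[OF _ \<psi>] K2.l_deriv K2.m_deriv)+
    show "(l3 has_real_derivative (1 - (l3 t)\<^sup>2 + (m3 t)\<^sup>2) / 2 * 1) (at t)"
      "(m3 has_real_derivative - l3 t * m3 t * 1) (at t)"
      using K3.l_deriv K3.m_deriv by simp_all
    show "l1 (\<phi> t) * (m2 (\<psi> t) + m3 t) + l2 (\<psi> t) * (m1 (\<phi> t) + m3 t) + l3 t * (m1 (\<phi> t) + m2 (\<psi> t)) = 0"
      "m1 (\<phi> t) * m2 (\<psi> t) + m2 (\<psi> t) * m3 t + m1 (\<phi> t) * m3 t =
        1 + (l1 (\<phi> t) * l2 (\<psi> t) + l2 (\<psi> t) * l3 t + l1 (\<phi> t) * l3 t)"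
      using mixed[OF sum0] pairs[OF sum0] by auto
  qed (use K1.m_pos K2.m_pos K3.m_pos in auto)
qed

text \<open>On the graph the first equation holds, and the second one reads
  \<open>G r = d\<close>.\<close>

definition G :: "real \<Rightarrow> real" where
  "G r = L1 (\<phi> r) + \<delta> * \<phi> r - (L2 (\<psi> r) - \<delta> * \<psi> r)"

abbreviation F :: "real \<Rightarrow> real" where "F r \<equiv> critical_sum \<delta> (\<phi> r) r"

text \<open>Implicit differentiation: the Jacobian determinant divided by the
  \<open>p\<close>-derivative \<open>l1 - \<delta>\<close> of the first equation. As this divisor is
  positive here, \<open>G\<close> rises or falls with the sign of \<open>F\<close>.\<close>

lemma G_derivative:
  assumes "p0 < \<phi> r"
  shows "(G has_real_derivative F r / (l1 (\<phi> r) - \<delta>)) (at r)"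
proof -
  let ?v1 = "(l3 r + \<delta>) / (l1 (\<phi> r) - \<delta>)"
  have w: "l1 (\<phi> r) - \<delta> \<noteq> 0"
    using above_p0[OF assms] by simp
  have \<psi>: "(\<psi> has_real_derivative - (?v1 + 1)) (at r)"
    using \<phi>_deriv[OF assms] by (auto intro!: derivative_eq_intros)
  have "(G has_real_derivative l1 (\<phi> r) * ?v1 + \<delta> * ?v1 - (l2 (\<psi> r) * - (?v1 + 1) - \<delta> * - (?v1 + 1))) (at r)"
    unfolding G_def
    by (intro DERIV_add DERIV_diff DERIV_cmult \<psi> \<phi>_deriv[OF assms]
        DERIV_chain2[OF K1.L_deriv \<phi>_deriv[OF assms]] DERIV_chain2[OF K2.L_deriv \<psi>])
  also have "l1 (\<phi> r) * ?v1 + \<delta> * ?v1 - (l2 (\<psi> r) * - (?v1 + 1) - \<delta> * - (?v1 + 1))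
    = F r / (l1 (\<phi> r) - \<delta>)"
  proof -
    have aux: "a * v + d * v - (b * - (v + 1) - d * - (v + 1)) = (a * b + b * z + a * z + d\<^sup>2) / (a - d)"
      if "v * (a - d) = z + d" "a - d \<noteq> 0" for a b d v z :: real
      unfolding nonzero_eq_divide_eq[OF that(2)] using that(1) by algebra
    show ?thesis
      unfolding critical_sum_def by (rule aux) (use w in simp_all)
  qed
  finally show ?thesis .
qed

lemma F_cont: "isCont F r"
proof -
  have *: "isCont (\<lambda>r. l1 (\<phi> r)) r" "isCont (\<lambda>r. l2 (\<psi> r)) r" "isCont l3 r"
    by (rule isCont_o2[OF _ DERIV_isCont[OF K1.l_deriv]] isCont_o2[OF _ DERIV_isCont[OF K2.l_deriv]]
        DERIV_isCont[OF K3.l_deriv] continuous_intros \<phi>_cont)+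
  show ?thesis
    unfolding critical_sum_def by (intro continuous_intros *)
qed

lemma G_cont: "isCont G r"
  unfolding G_def
  by (rule isCont_o2[OF _ DERIV_isCont[OF K1.L_deriv]] isCont_o2[OF _ DERIV_isCont[OF K2.L_deriv]]
      continuous_intros \<phi>_cont)+

text \<open>A point with \<open>\<phi> r = p0\<close> is the crossing point of the two graphs at the critical level; \<open>\<phi>\<close> has a corner
  there, but \<open>F\<close> vanishes.\<close>

lemma node:
  assumes "\<phi> r = p0"
  shows "l3 r = - \<delta>"
proof -
  have "((\<lambda>r. L3 r + \<delta> * r + c) has_real_derivative l3 r + \<delta>) (at r)"
    by (auto intro!: derivative_eq_intros K3.L_deriv)
  then have "l3 r + \<delta> = 0"
    by (rule DERIV_local_min[where d = 1]) (use level \<phi>_eq[of r] assms in auto)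
  then show ?thesis
    by simp
qed

lemma node_F: "\<phi> r = p0 \<Longrightarrow> F r = 0"
  using node[of r] by (simp add: critical_sum_def l1_p0 power2_eq_square)

lemma node_unique: "\<exists>e. \<forall>r. \<phi> r = p0 \<longrightarrow> r = e"
proof -
  obtain e where "\<And>s. s < e \<Longrightarrow> l3 s < - \<delta>" "\<And>s. e < s \<Longrightarrow> - \<delta> < l3 s"
    using K3.threshold[of "- \<delta>"] \<delta> by auto
  then show ?thesis
    using node by (intro exI[of _ e] allI impI) (metis linorder_less_linear order_less_irrefl)
qed

text \<open>Otherwise \<open>F\<close> would have an interior minimum with a negative value. There
  \<Psi> vanishes and decreases, so \<open>F\<close> would strictly increase just before its
  minimum.\<close>

lemma F_nonneg_between:
  assumes "s1 \<le> s" "s \<le> s2" "F s1 > 0" "F s2 > 0"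
  shows "F s \<ge> 0"
proof (rule ccontr)
  assume "\<not> F s \<ge> 0"
  then have "F s < 0"
    by simp
  obtain t where t: "s1 \<le> t" "t \<le> s2" and min: "\<And>r. s1 \<le> r \<Longrightarrow> r \<le> s2 \<Longrightarrow> F t \<le> F r"
    using continuous_attains_inf[of "{s1..s2}" F] F_cont assms(1,2)
    by (force simp: continuous_at_imp_continuous_on)
  have "F t < 0"
    using min[OF assms(1,2)] \<open>F s < 0\<close> by simp
  then have "s1 < t" "t < s2"
    using t assms(3,4) by (auto simp: less_le)
  \<comment> \<open>\<open>F\<close> vanishes at a corner, so a negative minimum lies where \<phi>
    is differentiable.\<close>
  have "p0 < \<phi> t"
    using \<phi>_ge[of t] node_F[of t] \<open>F t < 0\<close> by (auto simp: less_le)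
  let ?M = "\<lambda>t. moving_triple (\<lambda>r. l1 (\<phi> r)) (\<lambda>r. l2 (\<psi> r)) l3 (\<lambda>r. m1 (\<phi> r)) (\<lambda>r. m2 (\<psi> r)) m3
    ((l3 t + \<delta>) / (l1 (\<phi> t) - \<delta>)) (- ((l3 t + \<delta>) / (l1 (\<phi> t) - \<delta>) + 1)) 1 t \<delta>"
  let ?\<Psi> = "moving_triple.\<Psi> (\<lambda>r. l1 (\<phi> r)) (\<lambda>r. l2 (\<psi> r)) l3 (\<lambda>r. m1 (\<phi> r)) (\<lambda>r. m2 (\<psi> r)) m3 \<delta>"
  let ?k = "\<lambda>t. (m2 (\<psi> t) + m3 t) * (m1 (\<phi> t) + m3 t) * (m1 (\<phi> t) + m2 (\<psi> t)) / 2"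
  have F_moving: "moving_triple.F (\<lambda>r. l1 (\<phi> r)) (\<lambda>r. l2 (\<psi> r)) l3 \<delta> = F"
    by (simp add: fun_eq_iff moving_triple.F_def[OF moving[OF \<open>p0 < \<phi> t\<close>]] critical_sum_def)
  have k: "?k r > 0" for r
    by (intro divide_pos_pos mult_pos_pos add_pos_pos K1.m_pos K2.m_pos K3.m_pos) auto
  have dF: "(F has_real_derivative ?k r * ?\<Psi> r / (l1 (\<phi> r) - \<delta>)) (at r)" if "p0 < \<phi> r" for r
    using moving_triple.F_derivative[OF moving[OF that]] unfolding F_moving .
  have "?k t * ?\<Psi> t / (l1 (\<phi> t) - \<delta>) = 0"
    by (rule DERIV_local_min[OF dF[OF \<open>p0 < \<phi> t\<close>], of "min (t - s1) (s2 - t)"])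
      (use \<open>s1 < t\<close> \<open>t < s2\<close> min in auto)
  then have "?\<Psi> t = 0"
    using k[of t] above_p0[OF \<open>p0 < \<phi> t\<close>] by auto
  obtain D where D: "(?\<Psi> has_real_derivative D) (at t)" "D * (l1 (\<phi> t) - \<delta>) < 0"
    by (rule moving_triple.\<Psi>_derivative[OF moving[OF \<open>p0 < \<phi> t\<close>]])
      (use \<open>?\<Psi> t = 0\<close> \<open>F t < 0\<close> in \<open>simp add: F_moving\<close>)
  then have "D < 0"
    using above_p0[OF \<open>p0 < \<phi> t\<close>] by (simp add: mult_less_0_iff)
  then obtain d1 where d1: "d1 > 0" "\<And>h. 0 < h \<Longrightarrow> h < d1 \<Longrightarrow> ?\<Psi> (t - h) > 0"
    using DERIV_neg_dec_left[OF D(1)] \<open>?\<Psi> t = 0\<close> by auto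
  obtain d2 where "d2 > 0" and d2_aux: "\<And>r. r \<noteq> t \<Longrightarrow> dist r t < d2 \<Longrightarrow> p0 < \<phi> r"
    using order_tendstoD(1)[OF isContD[OF \<phi>_cont] \<open>p0 < \<phi> t\<close>] by (auto simp: eventually_at)
  have d2: "p0 < \<phi> r" if "\<bar>r - t\<bar> < d2" for r
    using d2_aux[of r] that \<open>p0 < \<phi> t\<close> by (cases "r = t") (auto simp: dist_real_def)
  define h where "h = min (min (d1 / 2) (d2 / 2)) (t - s1)"
  have h: "0 < h" "h < d1" "h < d2" "s1 \<le> t - h"
    using d1(1) \<open>d2 > 0\<close> \<open>s1 < t\<close> by (auto simp: h_def)
  have "F (t - h) < F t"
  proof (rule DERIV_pos_imp_increasing_open[where f = F])
    show "\<exists>y. (F has_real_derivative y) (at r) \<and> y > 0" if "t - h < r" "r < t" for r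
    proof (intro exI conjI)
      have "p0 < \<phi> r"
        using d2[of r] that h by auto
      then show "(F has_real_derivative ?k r * ?\<Psi> r / (l1 (\<phi> r) - \<delta>)) (at r)"
        by (rule dF)
      have "?\<Psi> r > 0"
        using d1(2)[of "t - r"] that h by auto
      then show "?k r * ?\<Psi> r / (l1 (\<phi> r) - \<delta>) > 0"
        using above_p0[OF \<open>p0 < \<phi> r\<close>] by (intro divide_pos_pos mult_pos_pos[OF k]) auto
    qed
    show "continuous_on {t - h..t} F"
      using F_cont by (simp add: continuous_at_imp_continuous_on)
  qed (use h in auto)
  then show False
    using min[of "t - h"] h \<open>t < s2\<close> by auto
qed

end

section \<open>Tilted kernels and the count on one graph\<close>

context log_kernel begin

lemma tilted_deriv: "((\<lambda>s. L s - d * s) has_real_derivative l s - d) (at s)"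
  by (auto intro!: derivative_eq_intros L_deriv)

lemma tilted_cont: "continuous_on S (\<lambda>s. L s - d * s)"
  by (intro continuous_at_imp_continuous_on ballI DERIV_isCont[OF tilted_deriv])

lemma tilted_less:
  assumes "\<And>s. p < s \<Longrightarrow> d < l s" "p \<le> s" "s < s'"
  shows "L s - d * s < L s' - d * s'"
  by (rule DERIV_pos_imp_increasing_open[OF \<open>s < s'\<close> _ tilted_cont])
    (use assms in \<open>force intro: exI[of _ "l _ - d"] tilted_deriv\<close>)

lemma tilted_min:
  assumes "\<And>s. s < p \<Longrightarrow> l s < d" "\<And>s. p < s \<Longrightarrow> d < l s"
  shows "L p - d * p \<le> L s - d * s"
proof (cases "p \<le> s")
  case True
  then show ?thesis
    using tilted_less[of p d p s] assms(2) by (cases "p = s") auto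
next
  case False
  have "\<exists>y. ((\<lambda>s. L s - d * s) has_real_derivative y) (at x) \<and> y \<le> 0" if "x < p" for x
    using assms(1)[OF that] by (intro exI[of _ "l x - d"] conjI tilted_deriv) auto
  then show ?thesis
    using False by (intro DERIV_nonpos_imp_decreasing_open[OF _ _ tilted_cont]) auto
qed

end

lemma card_le_1_of_no_less:
  fixes A :: "'a::linorder set"
  assumes eq: "\<And>x y. x \<in> A \<Longrightarrow> y \<in> A \<Longrightarrow> x \<le> y \<Longrightarrow> x = y"
  shows "finite A \<and> card A \<le> 1"
proof (cases "A = {}")
  case False
  then obtain x where "x \<in> A"
    by blast
  then have "A = {x}"
    using eq[of x] eq[of _ x] linear[of x] by blast
  then show ?thesis
    by simp
qed simp

text \<open>The last condition keeps only the points with nonzero Jacobian determinant; these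
  receive the nondegenerate equilibria.\<close>

definition (in log_kernel_triple) solutions :: "real \<Rightarrow> real \<Rightarrow> real \<Rightarrow> (real \<times> real) set" where
  "solutions \<delta> c d = {(p, r). L1 p - \<delta> * p = L3 r + \<delta> * r + c \<and>
    L1 p + \<delta> * p = L2 (- p - r) - \<delta> * (- p - r) + d \<and> critical_sum \<delta> p r \<noteq> 0}"

context upper_graph begin

lemma G_deriv_off_node:
  assumes "\<And>r. \<phi> r = p0 \<Longrightarrow> r = e" "r \<noteq> e"
  shows "(G has_real_derivative F r / (l1 (\<phi> r) - \<delta>)) (at r)" "l1 (\<phi> r) - \<delta> > 0"
proof -
  have "p0 < \<phi> r"
    using \<phi>_ge[of r] assms(1)[of r] assms(2) by (auto simp: less_le)
  then show "(G has_real_derivative F r / (l1 (\<phi> r) - \<delta>)) (at r)" "l1 (\<phi> r) - \<delta> > 0"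
    using G_derivative above_p0 by auto
qed

text \<open>Where \<open>F\<close> is nonpositive \<open>G\<close> cannot increase, and at
  \<open>r\<close> it strictly decreases because \<open>F r\<close> is nonzero.\<close>

lemma zeros_eq_of_nonpos:
  assumes "r \<le> r'" "G r = y" "G r' = y" "F r \<noteq> 0"
    and le: "\<And>s. r \<le> s \<Longrightarrow> s \<le> r' \<Longrightarrow> F s \<le> 0"
  shows "r = r'"
proof -
  obtain e where e: "\<And>r. \<phi> r = p0 \<Longrightarrow> r = e"
    using node_unique by blast
  have e_node: "\<phi> r \<noteq> p0"
    using node_F \<open>F r \<noteq> 0\<close> by blast
  \<comment> \<open>\<open>node_unique\<close> names a point even when there is no corner. The
    default \<open>r' + 1\<close> then lies outside the interval and differs from
    \<open>r\<close>.\<close>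
  define e' where "e' = (if \<phi> e = p0 then e else r' + 1)"
  have "r \<noteq> e'"
    using e_node \<open>r \<le> r'\<close> by (cases "\<phi> e = p0") (auto simp: e'_def)
  have node_e': "s = e'" if "\<phi> s = p0" for s
    using e[OF that] that by (simp add: e'_def)
  show ?thesis
  proof (rule equal_zeros_of_nonincreasing[where f = "\<lambda>s. G s - y" and e = e'])
    show "isCont (\<lambda>s. G s - y) s" for s
      by (intro continuous_intros G_cont)
    show "((\<lambda>s. G s - y) has_real_derivative F s / (l1 (\<phi> s) - \<delta>)) (at s)" if "s \<noteq> e'" for s
      using DERIV_diff[OF G_deriv_off_node(1)[OF node_e' that] DERIV_const[of y]] by simp
    show "F s / (l1 (\<phi> s) - \<delta>) \<le> 0" if "r \<le> s" "s \<le> r'" "s \<noteq> e'" for s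
      using G_deriv_off_node(2)[OF node_e' that(3)] le[OF that(1,2)] by (simp add: divide_nonpos_pos)
    show "F r / (l1 (\<phi> r) - \<delta>) \<noteq> 0"
      using G_deriv_off_node(2)[OF node_e' \<open>r \<noteq> e'\<close>] assms(4) by simp
  qed (use assms \<open>r \<noteq> e'\<close> in auto)
qed

lemma zeros_eq_of_nonneg:
  assumes "r \<le> r'" "G r = y" "G r' = y" "F r \<noteq> 0"
    and ge: "\<And>s. r \<le> s \<Longrightarrow> s \<le> r' \<Longrightarrow> F s \<ge> 0"
  shows "r = r'"
proof -
  obtain e where e: "\<And>r. \<phi> r = p0 \<Longrightarrow> r = e"
    using node_unique by blast
  have e_node: "\<phi> r \<noteq> p0"
    using node_F \<open>F r \<noteq> 0\<close> by blast
  define e' where "e' = (if \<phi> e = p0 then e else r' + 1)"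
  have "r \<noteq> e'"
    using e_node \<open>r \<le> r'\<close> by (cases "\<phi> e = p0") (auto simp: e'_def)
  have node_e': "s = e'" if "\<phi> s = p0" for s
    using e[OF that] that by (simp add: e'_def)
  show ?thesis
  proof (rule equal_zeros_of_nonincreasing[where f = "\<lambda>s. y - G s" and e = e'])
    show "isCont (\<lambda>s. y - G s) s" for s
      by (intro continuous_intros G_cont)
    show "((\<lambda>s. y - G s) has_real_derivative - (F s / (l1 (\<phi> s) - \<delta>))) (at s)" if "s \<noteq> e'" for s
      using DERIV_diff[OF DERIV_const[of y] G_deriv_off_node(1)[OF node_e' that]] by simp
    show "- (F s / (l1 (\<phi> s) - \<delta>)) \<le> 0" if "r \<le> s" "s \<le> r'" "s \<noteq> e'" for s
      using G_deriv_off_node(2)[OF node_e' that(3)] ge[OF that(1,2)] by simp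
    show "- (F r / (l1 (\<phi> r) - \<delta>)) \<noteq> 0"
      using G_deriv_off_node(2)[OF node_e' \<open>r \<noteq> e'\<close>] assms(4) by simp
  qed (use assms \<open>r \<noteq> e'\<close> in auto)
qed

text \<open>By \<open>F_nonneg_between\<close> the signs of \<open>F\<close> occur at most in the
  pattern minus, plus, minus, and \<open>G\<close> takes a value at most once in each group. If
  \<open>F\<close> is never positive, all negative points fall into \<open>?B\<close>.\<close>

lemma card_zeros: "finite {r. G r = y \<and> F r \<noteq> 0} \<and> card {r. G r = y \<and> F r \<noteq> 0} \<le> 3"
proof -
  let ?A = "{r. G r = y \<and> F r > 0}"
  let ?B = "{r. G r = y \<and> F r < 0 \<and> (\<forall>s. F s > 0 \<longrightarrow> r < s)}"
  let ?C = "{r. G r = y \<and> F r < 0 \<and> (\<exists>s<r. F s > 0)}"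
  have A: "finite ?A \<and> card ?A \<le> 1"
  proof (rule card_le_1_of_no_less)
    show "r = r'" if "r \<in> ?A" "r' \<in> ?A" "r \<le> r'" for r r'
      by (rule zeros_eq_of_nonneg[where y = y]) (use that F_nonneg_between in auto)
  qed
  have B: "finite ?B \<and> card ?B \<le> 1"
  proof (rule card_le_1_of_no_less)
    show "r = r'" if "r \<in> ?B" "r' \<in> ?B" "r \<le> r'" for r r'
      by (rule zeros_eq_of_nonpos[where y = y]) (use that in \<open>auto simp: not_less[symmetric]\<close>)
  qed
  have C: "finite ?C \<and> card ?C \<le> 1"
  proof (rule card_le_1_of_no_less)
    show "r = r'" if r: "r \<in> ?C" "r' \<in> ?C" "r \<le> r'" for r r'
    proof (rule zeros_eq_of_nonpos[where y = y])
      fix s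
      assume "r \<le> s" "s \<le> r'"
      show "F s \<le> 0"
      proof (rule ccontr)
        assume "\<not> F s \<le> 0"
        moreover obtain s0 where "s0 < r" "F s0 > 0"
          using r by auto
        ultimately have "F r \<ge> 0"
          using F_nonneg_between[of s0 r s] \<open>r \<le> s\<close> by auto
        then show False
          using r by auto
      qed
    qed (use r in auto)
  qed
  have "{r. G r = y \<and> F r \<noteq> 0} = ?A \<union> ?B \<union> ?C"
    using antisym_conv3[of "0::real"] not_less_iff_gr_or_eq by auto
  moreover have "card (?A \<union> ?B \<union> ?C) \<le> card ?A + card ?B + card ?C"
    by (meson add_mono_thms_linordered_semiring(3) card_Un_le order_trans)
  ultimately show ?thesis
    using A B C by simp
qed

lemma graph_unique:
  assumes "p \<ge> p0" "L1 p - \<delta> * p = L3 r + \<delta> * r + c"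
  shows "p = \<phi> r"
  using K1.tilted_less[of p0 \<delta> p "\<phi> r"] K1.tilted_less[of p0 \<delta> "\<phi> r" p] above_p0
    \<phi>_ge[of r] \<phi>_eq[of r] assms by (cases p "\<phi> r" rule: linorder_cases) auto

lemma card_upper_solutions:
  "finite {(p, r) \<in> solutions \<delta> c d. p \<ge> p0} \<and> card {(p, r) \<in> solutions \<delta> c d. p \<ge> p0} \<le> 3"
proof -
  let ?S = "{(p, r) \<in> solutions \<delta> c d. p \<ge> p0}"
  let ?Z = "{r. G r = d \<and> F r \<noteq> 0}"
  have graph: "p = \<phi> r" if "(p, r) \<in> ?S" for p r
    using graph_unique[of p r] that by (auto simp: solutions_def)
  have "inj_on snd ?S"
    using graph by (auto simp: inj_on_def)
  moreover have "snd ` ?S \<subseteq> ?Z"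
    using graph by (force simp: solutions_def G_def)
  ultimately show ?thesis
    using card_zeros[of d] by (meson card_inj_on_le finite_imageD finite_subset order_trans)
qed

end

section \<open>Both graphs together\<close>

context log_kernel_triple begin

lemma card_upper_solutions:
  assumes "\<bar>\<delta>\<bar> < 1" "\<And>s. s < p0 \<Longrightarrow> l1 s < \<delta>" "\<And>s. p0 < s \<Longrightarrow> \<delta> < l1 s"
    and "\<And>r. L3 r + \<delta> * r + c \<ge> L1 p0 - \<delta> * p0"
  shows "finite {(p, r) \<in> solutions \<delta> c d. p \<ge> p0} \<and> card {(p, r) \<in> solutions \<delta> c d. p \<ge> p0} \<le> 3"
proof -
  have h: "((\<lambda>r. L3 r + \<delta> * r + c) has_real_derivative l3 r + \<delta>) (at r)" for r
    by (auto intro!: derivative_eq_intros K3.L_deriv)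
  obtain \<phi> where "\<And>r. \<phi> r \<ge> p0" "\<And>r. L1 (\<phi> r) - \<delta> * \<phi> r = L3 r + \<delta> * r + c" "\<And>r. isCont \<phi> r"
    "\<And>r. p0 < \<phi> r \<Longrightarrow> (\<phi> has_real_derivative (l3 r + \<delta>) / (l1 (\<phi> r) - \<delta>)) (at r)"
    by (rule implicit_graph[OF K1.tilted_deriv _ K1.tilted_at_top[OF assms(1)] h assms(4)])
      (use assms(3) in auto)
  then interpret upper_graph L1 l1 m1 L2 l2 m2 L3 l3 m3 \<delta> p0 c \<phi>
    using assms by unfold_locales auto
  show ?thesis
    by (rule card_upper_solutions)
qed

text \<open>The part with \<open>p \<le> p0\<close> becomes an upper graph of the reflected kernels,
  with - \<delta> and - p0. Each part has at most three solutions; an overlap at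
  \<open>p = p0\<close> only lowers the count.\<close>

lemma card_solutions_of_level:
  assumes \<delta>: "\<bar>\<delta>\<bar> < 1" and p0: "\<And>s. s < p0 \<Longrightarrow> l1 s < \<delta>" "\<And>s. p0 < s \<Longrightarrow> \<delta> < l1 s"
    and level: "\<And>r. L3 r + \<delta> * r + c \<ge> L1 p0 - \<delta> * p0"
  shows "finite (solutions \<delta> c d) \<and> card (solutions \<delta> c d) \<le> 6"
proof -
  let ?U = "{(p, r) \<in> solutions \<delta> c d. p \<ge> p0}"
  let ?L = "{(p, r) \<in> solutions \<delta> c d. p \<le> p0}"
  interpret R: log_kernel_triple "\<lambda>s. L1 (- s)" "\<lambda>s. - l1 (- s)" "\<lambda>s. m1 (- s)"
    "\<lambda>s. L2 (- s)" "\<lambda>s. - l2 (- s)" "\<lambda>s. m2 (- s)"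
    "\<lambda>s. L3 (- s)" "\<lambda>s. - l3 (- s)" "\<lambda>s. m3 (- s)"
    by (rule triple_reflect)
  let ?R = "{(p, r) \<in> R.solutions (- \<delta>) c d. p \<ge> - p0}"
  have R: "finite ?R \<and> card ?R \<le> 3"
  proof (rule R.card_upper_solutions)
    show "L3 (- r) + - \<delta> * r + c \<ge> L1 (- (- p0)) - - \<delta> * - p0" for r
      using level[of "- r"] by simp
  qed (use \<delta> p0 in auto)
  have sub: "(\<lambda>(p, r). (- p, - r)) ` ?L \<subseteq> ?R"
    by (auto simp: solutions_def R.solutions_def critical_sum_def R.critical_sum_def algebra_simps)
  have inj: "inj_on (\<lambda>(p, r). (- p, - r)) ?L"
    by (auto simp: inj_on_def)
  have L: "finite ?L \<and> card ?L \<le> 3"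
    using R sub inj by (meson card_inj_on_le finite_imageD finite_subset order_trans)
  have U: "finite ?U \<and> card ?U \<le> 3"
    by (rule card_upper_solutions[OF assms])
  have eq: "?U \<union> ?L = solutions \<delta> c d"
    by auto
  have "finite (?U \<union> ?L) \<and> card (?U \<union> ?L) \<le> 6"
    using U L card_Un_le[of ?U ?L] by auto
  then show ?thesis
    by (simp only: eq)
qed

text \<open>The V-shaped side with the lower minimum takes every value of the other side, so the
  first equation can be solved for its variable: for \<open>p\<close> over every \<open>r\<close>,
  or for \<open>r\<close> over every \<open>p\<close>.\<close>

theorem card_solutions:
  assumes \<delta>: "\<bar>\<delta>\<bar> < 1"
  shows "finite (solutions \<delta> c d) \<and> card (solutions \<delta> c d) \<le> 6"
proof -
  obtain p0 where p0: "\<And>s. s < p0 \<Longrightarrow> l1 s < \<delta>" "\<And>s. p0 < s \<Longrightarrow> \<delta> < l1 s"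
    using K1.threshold[OF \<delta>] by blast
  obtain r0 where r0: "\<And>s. s < r0 \<Longrightarrow> l3 s < - \<delta>" "\<And>s. r0 < s \<Longrightarrow> - \<delta> < l3 s"
    using K3.threshold[of "- \<delta>"] \<delta> by auto
  show ?thesis
  proof (cases "\<forall>r. L3 r + \<delta> * r + c \<ge> L1 p0 - \<delta> * p0")
    case True
    then show ?thesis
      using card_solutions_of_level[OF \<delta> p0] by blast
  next
    case False
    then obtain r1 where r1: "L3 r1 + \<delta> * r1 + c < L1 p0 - \<delta> * p0"
      by (auto simp: not_le)
    interpret S: log_kernel_triple L3 l3 m3 L2 l2 m2 L1 l1 m1
      by (rule triple_swap)
    interpret R: log_kernel_triple "\<lambda>s. L3 (- s)" "\<lambda>s. - l3 (- s)" "\<lambda>s. m3 (- s)"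
      "\<lambda>s. L2 (- s)" "\<lambda>s. - l2 (- s)" "\<lambda>s. m2 (- s)"
      "\<lambda>s. L1 (- s)" "\<lambda>s. - l1 (- s)" "\<lambda>s. m1 (- s)"
      by (rule S.triple_reflect)
    \<comment> \<open>The new unknowns are - r and - p. The first equation is read backwards and
      subtracted from the second, which is rewritten with p + q + r = 0; hence the constants - c and
      d - c.\<close>
    have R: "finite (R.solutions \<delta> (- c) (d - c)) \<and> card (R.solutions \<delta> (- c) (d - c)) \<le> 6"
    proof (rule R.card_solutions_of_level[OF \<delta>])
      show "- l3 (- s) < \<delta>" if "s < - r0" for s
        using r0(2)[of "- s"] that by simp
      show "\<delta> < - l3 (- s)" if "- r0 < s" for s
        using r0(1)[of "- s"] that by simp
      show "L1 (- r) + \<delta> * r + - c \<ge> L3 (- (- r0)) - \<delta> * - r0" for r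
        using K1.tilted_min[of p0 \<delta> "- r", OF p0] K3.tilted_min[of r0 "- \<delta>" r1, OF r0] r1 by simp
    qed
    have sub: "(\<lambda>(p, r). (- r, - p)) ` solutions \<delta> c d \<subseteq> R.solutions \<delta> (- c) (d - c)"
      by (auto simp: solutions_def R.solutions_def critical_sum_def R.critical_sum_def algebra_simps)
    have inj: "inj_on (\<lambda>(p, r). (- r, - p)) (solutions \<delta> c d)"
      by (auto simp: inj_on_def)
    show ?thesis
      using R sub inj by (meson card_inj_on_le finite_imageD finite_subset order_trans)
  qed
qed

end

section \<open>The kernels of a triangle\<close>

text \<open>The law of cosines without angles: \<open>a\<close> and \<open>b\<close> are two squared sides, \<open>k\<close> is the inner product of the
  corresponding edge vectors and \<open>S\<close> twice the area. The variable is shifted against the model above.\<close>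

locale cosh_kernel =
  fixes a b k S :: real
  assumes a_pos: "a > 0" and b_pos: "b > 0" and S_pos: "S > 0" and ab: "a * b = k\<^sup>2 + S\<^sup>2"
begin

definition den :: "real \<Rightarrow> real" where "den s = a * exp s + b * exp (- s) + 2 * k"
definition L :: "real \<Rightarrow> real" where "L s = ln (den s)"
definition l :: "real \<Rightarrow> real" where "l s = (a * exp s - b * exp (- s)) / den s"
definition m :: "real \<Rightarrow> real" where "m s = 2 * S / den s"

lemma exp_exp_minus: "exp s * exp (- s) = (1 :: real)"
  by (simp add: exp_minus)

lemma den_pos: "den s > 0"
proof -
  have "(a * exp s + b * exp (- s))\<^sup>2 = (a * exp s - b * exp (- s))\<^sup>2 + 4 * (a * b)"
    using exp_exp_minus[of s] by algebra
  also have "\<dots> > (2 * k)\<^sup>2"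
    using S_pos unfolding ab by (simp add: power_mult_distrib add_nonneg_pos)
  finally have "(- (2 * k))\<^sup>2 < (a * exp s + b * exp (- s))\<^sup>2"
    by simp
  moreover have "0 \<le> a * exp s + b * exp (- s)"
    using a_pos b_pos by (intro add_nonneg_nonneg) auto
  ultimately have "- (2 * k) < a * exp s + b * exp (- s)"
    by (rule power2_less_imp_less)
  then show ?thesis
    by (simp add: den_def)
qed

lemma den_deriv: "(den has_real_derivative a * exp s - b * exp (- s)) (at s)"
  unfolding den_def by (auto intro!: derivative_eq_intros)

text \<open>Brings the quotient rule for \<open>l\<close> into the form required of a
  kernel.\<close>

lemma den_square: "(den s)\<^sup>2 - 4 * k * den s - (a * exp s - b * exp (- s))\<^sup>2 = 4 * S\<^sup>2"
  unfolding den_def using exp_exp_minus[of s] ab by algebra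

lemma log_kernel: "log_kernel L l m"
proof
  fix s
  have nz: "den s \<noteq> 0"
    using den_pos[of s] by simp
  show "(L has_real_derivative l s) (at s)"
    unfolding L_def l_def using den_pos[of s]
    by (auto intro!: derivative_eq_intros den_deriv simp: field_simps)
  let ?n = "a * exp s - b * exp (- s)"
  have n: "((\<lambda>s. a * exp s - b * exp (- s)) has_real_derivative a * exp s + b * exp (- s)) (at s)"
    by (auto intro!: derivative_eq_intros)
  have "(a * exp s + b * exp (- s)) * den s - ?n * ?n = (den s * den s - ?n\<^sup>2 + (2 * S)\<^sup>2) / 2"
    using den_square[of s] unfolding den_def by (simp add: power2_eq_square field_simps)
  moreover have "(1 - (n / D)\<^sup>2 + (M / D)\<^sup>2) / 2 = ((D * D - n\<^sup>2 + M\<^sup>2) / 2) / (D * D)"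
    if "D \<noteq> 0" for n M D :: real
    using that by (simp add: power_divide power2_eq_square add_divide_distrib diff_divide_distrib)
  ultimately have eq: "((a * exp s + b * exp (- s)) * den s - ?n * ?n) / (den s * den s)
      = (1 - (l s)\<^sup>2 + (m s)\<^sup>2) / 2"
    unfolding l_def m_def using nz by presburger
  have "l = (\<lambda>s. (a * exp s - b * exp (- s)) / den s)"
    by (simp add: fun_eq_iff l_def)
  then show "(l has_real_derivative (1 - (l s)\<^sup>2 + (m s)\<^sup>2) / 2) (at s)"
    using DERIV_divide[OF n den_deriv nz] by (simp only: eq)
  have "(m has_real_derivative (0 * den s - 2 * S * ?n) / (den s * den s)) (at s)"
    unfolding m_def by (rule DERIV_divide[OF DERIV_const den_deriv nz])
  also have "(0 * den s - 2 * S * ?n) / (den s * den s) = - l s * m s"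
    by (simp add: l_def m_def mult.commute)
  finally show "(m has_real_derivative - l s * m s) (at s)" .
  show "m s > 0"
    using den_pos[of s] S_pos by (simp add: m_def)
next
  fix d :: real
  assume d: "\<bar>d\<bar> < 1"
  \<comment> \<open>Clearing the denominator turns \<open>l s < d\<close> into
    \<open>g s < 2 * d * k\<close>. Both exponential terms make \<open>g\<close> increase because
    \<bar>d\<bar> < 1.\<close>
  define g where "g s = (1 - d) * a * exp s - (1 + d) * b * exp (- s)" for s
  have g_less: "g s < g s'" if "s < s'" for s s'
  proof -
    have "(1 - d) * a * exp s < (1 - d) * a * exp s'" "(1 + d) * b * exp (- s') < (1 + d) * b * exp (- s)"
      using that d a_pos b_pos by (auto intro!: mult_strict_left_mono mult_pos_pos)
    then show ?thesis
      by (simp add: g_def)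
  qed
  have l_less: "l s < d \<longleftrightarrow> g s < 2 * d * k" "d < l s \<longleftrightarrow> 2 * d * k < g s" for s
    using den_pos[of s] by (auto simp: l_def g_def pos_divide_less_eq pos_less_divide_eq)
      (simp_all add: den_def algebra_simps)
  define A B where "A = (1 - d) * a" and "B = (1 + d) * b"
  have AB: "A > 0" "B > 0"
    using d a_pos b_pos by (auto simp: A_def B_def)
  \<comment> \<open>\<open>(d * k + q) / A\<close> is the positive root of A X^2 - 2 d k X - B, the
    equation for X = exp p at the threshold.\<close>
  define q where "q = sqrt ((d * k)\<^sup>2 + A * B)"
  have q: "q\<^sup>2 = (d * k)\<^sup>2 + A * B"
    using AB by (simp add: q_def)
  have "\<bar>d * k\<bar> < q"
    unfolding q_def using AB by (intro real_less_rsqrt) simp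
  then have X: "(d * k + q) / A > 0"
    using AB by simp
  define p where "p = ln ((d * k + q) / A)"
  have exp_p: "exp p = (d * k + q) / A"
    using X by (simp add: p_def)
  have "A * (exp p)\<^sup>2 - B = 2 * d * k * exp p"
    using q AB unfolding exp_p by (simp add: power_divide field_simps power2_eq_square)
  then have "(g p - 2 * d * k) * exp p = 0"
    using exp_exp_minus[of p] unfolding g_def A_def[symmetric] B_def[symmetric] by algebra
  then have "g p = 2 * d * k"
    by simp
  then show "\<exists>p. \<forall>s. (s < p \<longrightarrow> l s < d) \<and> (p < s \<longrightarrow> d < l s)"
    using g_less[of _ p] g_less[of p] by (intro exI[of _ p]) (auto simp: l_less)
qed

end

text \<open>Replaces exponentials by a quadratic form in two weights. For the weights of an
  equilibrium this form will be the squared total weight times a squared distance.\<close>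

lemma ratio_kernel:
  fixes x y a b k S :: real
  assumes "x > 0" "y > 0" "cosh_kernel a b k S"
  shows "cosh_kernel.l a b k (ln x - ln y) = (a * x\<^sup>2 - b * y\<^sup>2) / (a * x\<^sup>2 + b * y\<^sup>2 + 2 * k * x * y)"
    and "cosh_kernel.m a b k S (ln x - ln y) = 2 * S * x * y / (a * x\<^sup>2 + b * y\<^sup>2 + 2 * k * x * y)"
    and "cosh_kernel.L a b k (ln x - ln y) = ln (a * x\<^sup>2 + b * y\<^sup>2 + 2 * k * x * y) - ln x - ln y"
    and "a * x\<^sup>2 + b * y\<^sup>2 + 2 * k * x * y > 0"
proof -
  interpret cosh_kernel a b k S
    by fact
  let ?R = "a * x\<^sup>2 + b * y\<^sup>2 + 2 * k * x * y"
  have e: "exp (ln x - ln y) = x / y" "exp (- (ln x - ln y)) = y / x"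
    using assms by (auto simp: exp_diff)
  have den: "den (ln x - ln y) = ?R / (x * y)"
    unfolding den_def e using assms by (simp add: field_simps power2_eq_square)
  have n: "a * exp (ln x - ln y) - b * exp (- (ln x - ln y)) = (a * x\<^sup>2 - b * y\<^sup>2) / (x * y)"
    unfolding e using assms by (simp add: field_simps power2_eq_square)
  show R: "?R > 0"
    using den_pos[of "ln x - ln y"] mult_pos_pos[OF assms(1,2)] unfolding den
    by (simp add: zero_less_divide_iff)
  show "l (ln x - ln y) = (a * x\<^sup>2 - b * y\<^sup>2) / ?R"
    unfolding l_def n den using assms by simp
  show "m (ln x - ln y) = 2 * S * x * y / ?R"
    unfolding m_def den using assms by simp
  show "L (ln x - ln y) = ln ?R - ln x - ln y"
    unfolding L_def den using assms R by (simp add: ln_div ln_mult)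
qed

text \<open>Each \<open>k\<close> will be the inner product of the edge vectors at one vertex, so
  the sums of two are the squared sides, and the formula for \<open>S\<close> is Heron's.\<close>

locale triangle =
  fixes k1 k2 k3 S :: real
  assumes S: "S > 0" "S\<^sup>2 = k1 * k2 + k2 * k3 + k1 * k3"
    and sides: "k1 + k2 > 0" "k2 + k3 > 0" "k3 + k1 > 0"
begin

sublocale K1: cosh_kernel "k1 + k2" "k1 + k3" k1 S
  using S sides by unfold_locales (auto simp: algebra_simps power2_eq_square)
sublocale K2: cosh_kernel "k2 + k3" "k2 + k1" k2 S
  using S sides by unfold_locales (auto simp: algebra_simps power2_eq_square)
sublocale K3: cosh_kernel "k3 + k1" "k3 + k2" k3 S
  using S sides by unfold_locales (auto simp: algebra_simps power2_eq_square)

lemma triple: "log_kernel_triple K1.L K1.l K1.m K2.L K2.l K2.m K3.L K3.l K3.m"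
proof (intro log_kernel_triple.intro log_kernel_triple_axioms.intro
    K1.log_kernel K2.log_kernel K3.log_kernel)
  fix p q r :: real
  assume "p + q + r = 0"
  \<comment> \<open>Numbers p, q, r with sum zero are the logarithmic ratios of the weights w1 = x,
    w2 = y, w3 = 1. Without denominators the addition theorem becomes two polynomial
    identities.\<close>
  define x where "x = exp (- q)"
  define y where "y = exp p"
  have xy: "x > 0" "y > 0"
    by (auto simp: x_def y_def)
  have p: "p = ln y - ln 1" and q: "q = ln 1 - ln x" and r: "r = ln x - ln y"
    using \<open>p + q + r = 0\<close> by (auto simp: x_def y_def)
  note k1 = ratio_kernel[OF xy(2) zero_less_one K1.cosh_kernel_axioms, folded p]
  note k2 = ratio_kernel[OF zero_less_one xy(1) K2.cosh_kernel_axioms, folded q]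
  note k3 = ratio_kernel[OF xy K3.cosh_kernel_axioms, folded r]
  define R1 where "R1 = (k1 + k2) * y\<^sup>2 + (k1 + k3) + 2 * k1 * y"
  define R2 where "R2 = (k2 + k3) + (k2 + k1) * x\<^sup>2 + 2 * k2 * x"
  define R3 where "R3 = (k3 + k1) * x\<^sup>2 + (k3 + k2) * y\<^sup>2 + 2 * k3 * x * y"
  define N1 where "N1 = (k1 + k2) * y\<^sup>2 - (k1 + k3)"
  define N2 where "N2 = (k2 + k3) - (k2 + k1) * x\<^sup>2"
  define N3 where "N3 = (k3 + k1) * x\<^sup>2 - (k3 + k2) * y\<^sup>2"
  have R: "R1 \<noteq> 0" "R2 \<noteq> 0" "R3 \<noteq> 0"
    using k1(4) k2(4) k3(4) by (auto simp: R1_def R2_def R3_def)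
  have l: "K1.l p = N1 / R1" "K2.l q = N2 / R2" "K3.l r = N3 / R3"
    unfolding k1 k2 k3 by (auto simp: R1_def R2_def R3_def N1_def N2_def N3_def)
  have m: "K1.m p = 2 * S * y / R1" "K2.m q = 2 * S * x / R2" "K3.m r = 2 * S * x * y / R3"
    unfolding k1 k2 k3 by (auto simp: R1_def R2_def R3_def)
  have "N1 * (x * R3 + x * y * R2) + N2 * (y * R3 + x * y * R1) + N3 * (y * R2 + x * R1) = 0"
    unfolding R1_def R2_def R3_def N1_def N2_def N3_def by algebra
  moreover have "N1 / R1 * (2 * S * x / R2 + 2 * S * x * y / R3) + N2 / R2 * (2 * S * y / R1 + 2 * S * x * y / R3)
      + N3 / R3 * (2 * S * y / R1 + 2 * S * x / R2)
    = 2 * S * (N1 * (x * R3 + x * y * R2) + N2 * (y * R3 + x * y * R1) + N3 * (y * R2 + x * R1)) / (R1 * R2 * R3)"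
    using R by (simp add: field_simps)
  ultimately show "K1.l p * (K2.m q + K3.m r) + K2.l q * (K1.m p + K3.m r) + K3.l r * (K1.m p + K2.m q) = 0"
    unfolding l m by simp
  have "4 * (k1 * k2 + k2 * k3 + k1 * k3) * x * y * (R3 + x * R1 + y * R2)
      = R1 * R2 * R3 + (N1 * N2 * R3 + N2 * N3 * R1 + N1 * N3 * R2)"
    unfolding R1_def R2_def R3_def N1_def N2_def N3_def by algebra
  then have "4 * S\<^sup>2 * x * y * (R3 + x * R1 + y * R2) / (R1 * R2 * R3)
      = 1 + (N1 * N2 * R3 + N2 * N3 * R1 + N1 * N3 * R2) / (R1 * R2 * R3)"
    unfolding S(2) using R by (simp add: add_divide_distrib)
  moreover have "2 * S * y / R1 * (2 * S * x / R2) + 2 * S * x / R2 * (2 * S * x * y / R3)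
      + 2 * S * y / R1 * (2 * S * x * y / R3) = 4 * S\<^sup>2 * x * y * (R3 + x * R1 + y * R2) / (R1 * R2 * R3)"
    using R by (simp add: field_simps power2_eq_square)
  moreover have "N1 / R1 * (N2 / R2) + N2 / R2 * (N3 / R3) + N1 / R1 * (N3 / R3)
      = (N1 * N2 * R3 + N2 * N3 * R1 + N1 * N3 * R2) / (R1 * R2 * R3)"
    using R by (simp add: field_simps)
  ultimately show "K1.m p * K2.m q + K2.m q * K3.m r + K1.m p * K3.m r =
      1 + (K1.l p * K2.l q + K2.l q * K3.l r + K1.l p * K3.l r)"
    unfolding l m by simp
qed

end

section \<open>Gradient and Hessian of the potential\<close>

lemma singular_2x2:
  fixes a b c d :: real
  assumes "a * d = b * c"
  obtains x y where "a * x + b * y = 0" "c * x + d * y = 0" "x \<noteq> 0 \<or> y \<noteq> 0"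
proof (cases "a = 0 \<and> b = 0")
  case True
  show thesis
  proof (cases "c = 0 \<and> d = 0")
    case False
    then show thesis
      using that[of d "- c"] True by (auto simp: algebra_simps)
  qed (use that[of 1 0] True in auto)
next
  case False
  then show thesis
    using that[of b "- a"] assms by (auto simp: algebra_simps)
qed

text \<open>The vector \<open>h\<close> is the velocity of \<open>x\<close> when the weights move by \<open>w\<^sub>i' = w\<^sub>i \<tau>\<^sub>i\<close> so that all three equations
  \<open>w\<^sub>i = \<zeta>\<^sub>i \<rho>\<^sub>i powr (- \<gamma>)\<close> persist to first order.\<close>

lemma degenerate_direction:
  fixes y1 y2 y3 :: "'a::real_inner" and w1 w2 w3 l1 l2 l3 \<gamma> \<delta> :: real
  assumes w: "w1 > 0" "w2 > 0" "w3 > 0" and y: "y1 \<noteq> 0" "y2 \<noteq> 0" "y3 \<noteq> 0"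
    and bary: "w1 *\<^sub>R y1 + w2 *\<^sub>R y2 + w3 *\<^sub>R y3 = 0"
    and l1: "l1 * (w1 + w2 + w3) * (y1 \<bullet> y1) = (w2 - w3) * (y1 \<bullet> y1) - w2 * (y1 \<bullet> y2) + w3 * (y1 \<bullet> y3)"
    and l2: "l2 * (w1 + w2 + w3) * (y2 \<bullet> y2) = (w3 - w1) * (y2 \<bullet> y2) - w3 * (y2 \<bullet> y3) + w1 * (y1 \<bullet> y2)"
    and l3: "l3 * (w1 + w2 + w3) * (y3 \<bullet> y3) = (w1 - w2) * (y3 \<bullet> y3) - w1 * (y1 \<bullet> y3) + w2 * (y2 \<bullet> y3)"
    and crit: "l1 * l2 + l2 * l3 + l1 * l3 + \<delta>\<^sup>2 = 0"
    and \<gamma>: "\<gamma> * (1 - \<delta>) = 1"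
  obtains h where "h \<noteq> 0" "(w1 + w2 + w3) *\<^sub>R h = (2 * \<gamma>) *\<^sub>R ((w1 * (y1 \<bullet> h) / (y1 \<bullet> y1)) *\<^sub>R y1
    + (w2 * (y2 \<bullet> h) / (y2 \<bullet> y2)) *\<^sub>R y2 + (w3 * (y3 \<bullet> h) / (y3 \<bullet> y3)) *\<^sub>R y3)"
proof -
  \<comment> \<open>\<open>crit\<close> is the vanishing determinant of the linearised separated
    equations in the velocities v1 = \<tau>2 - \<tau>3 and v2 = \<tau>3 - \<tau>1.\<close>
  have "(l1 + l3) * - (l2 - \<delta>) = (l3 + \<delta>) * (l1 + \<delta>)"
    using crit by algebra
  then obtain v1 v2 where v: "(l1 + l3) * v1 + (l3 + \<delta>) * v2 = 0" "(l1 + \<delta>) * v1 + - (l2 - \<delta>) * v2 = 0"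
    and v_nz: "v1 \<noteq> 0 \<or> v2 \<noteq> 0"
    by (rule singular_2x2)
  define W where "W = w1 + w2 + w3"
  have W: "W > 0"
    using w by (simp add: W_def)
  have \<delta>1: "\<delta> - 1 \<noteq> 0"
    using \<gamma> by auto
  \<comment> \<open>The separated equations involve only ratios of weights. The common rate is fixed
    by \<open>K3\<close>, a linear equation for \<tau>3 with leading coefficient W (\<delta> -
    1).\<close>
  define \<tau>3 where "\<tau>3 = (W * l3 * - (v1 + v2) + W * (v1 - v2) - 2 * (w2 * v1 - w1 * v2)) / (W * (\<delta> - 1))"
  define \<tau>2 where "\<tau>2 = \<tau>3 + v1"
  define \<tau>1 where "\<tau>1 = \<tau>3 - v2"
  have \<tau>3: "\<tau>3 * (W * (\<delta> - 1)) = W * l3 * - (v1 + v2) + W * (v1 - v2) - 2 * (w2 * v1 - w1 * v2)"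
    using W \<delta>1 by (simp add: \<tau>3_def)
  let ?K = "W * (\<tau>1 + \<tau>2 + \<tau>3) - 2 * (w1 * \<tau>1 + w2 * \<tau>2 + w3 * \<tau>3)"
  have K3: "W * (\<delta> * \<tau>3 - l3 * (\<tau>1 - \<tau>2)) = ?K"
    using \<tau>3 unfolding \<tau>1_def \<tau>2_def by (simp add: W_def algebra_simps)
  have "\<delta> * \<tau>1 - l1 * (\<tau>2 - \<tau>3) = \<delta> * \<tau>3 - l3 * (\<tau>1 - \<tau>2)"
    using v unfolding \<tau>1_def \<tau>2_def by (simp add: algebra_simps)
  then have K1: "W * (\<delta> * \<tau>1 - l1 * (\<tau>2 - \<tau>3)) = ?K"
    using K3 by simp
  have "\<delta> * \<tau>2 - l2 * (\<tau>3 - \<tau>1) = \<delta> * \<tau>1 - l1 * (\<tau>2 - \<tau>3)"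
    using v unfolding \<tau>1_def \<tau>2_def by (simp add: algebra_simps)
  then have K2: "W * (\<delta> * \<tau>2 - l2 * (\<tau>3 - \<tau>1)) = ?K"
    using K1 by simp
  \<comment> \<open>Obtained by differentiating the barycentric relation.\<close>
  define h where "h = (- 1 / W) *\<^sub>R ((w1 * \<tau>1) *\<^sub>R y1 + (w2 * \<tau>2) *\<^sub>R y2 + (w3 * \<tau>3) *\<^sub>R y3)"
  have Wh: "W *\<^sub>R h = - ((w1 * \<tau>1) *\<^sub>R y1 + (w2 * \<tau>2) *\<^sub>R y2 + (w3 * \<tau>3) *\<^sub>R y3)"
    using W by (simp add: h_def scaleR_minus_left)
  have bary_inner: "w1 * (y1 \<bullet> z) + w2 * (y2 \<bullet> z) + w3 * (y3 \<bullet> z) = 0" for z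
    using arg_cong[OF bary, of "\<lambda>v. v \<bullet> z"] by (simp add: inner_add_left)
  have Wh_inner: "W * (z \<bullet> h) = - (w1 * \<tau>1 * (y1 \<bullet> z) + w2 * \<tau>2 * (y2 \<bullet> z) + w3 * \<tau>3 * (y3 \<bullet> z))" for z
    using arg_cong[OF Wh, of "\<lambda>v. v \<bullet> z"] by (simp add: inner_add_left inner_commute algebra_simps)
  \<comment> \<open>The linearised weight law: 2 (y1 \<bullet> h) is the velocity of \<rho>1, and 1
    - \<delta> = 1 / \<gamma>.\<close>
  have 1: "W * (2 * (y1 \<bullet> h)) = W * (- (1 - \<delta>) * \<tau>1 * (y1 \<bullet> y1))"
    using Wh_inner[of y1] bary_inner[of y1] l1 K1 unfolding W_def[symmetric]
    unfolding W_def inner_commute[of y2 y1] inner_commute[of y3 y1] by algebra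
  have 2: "W * (2 * (y2 \<bullet> h)) = W * (- (1 - \<delta>) * \<tau>2 * (y2 \<bullet> y2))"
    using Wh_inner[of y2] bary_inner[of y2] l2 K2 unfolding W_def[symmetric]
    unfolding W_def inner_commute[of y2 y1] inner_commute[of y3 y2] by algebra
  have 3: "W * (2 * (y3 \<bullet> h)) = W * (- (1 - \<delta>) * \<tau>3 * (y3 \<bullet> y3))"
    using Wh_inner[of y3] bary_inner[of y3] l3 K3 unfolding W_def[symmetric]
    unfolding W_def inner_commute[of y3 y1] inner_commute[of y3 y2] by algebra
  have ratio: "2 * \<gamma> * (w * (z \<bullet> h) / (z \<bullet> z)) = - (w * \<tau>)"
    if "W * (2 * (z \<bullet> h)) = W * (- (1 - \<delta>) * \<tau> * (z \<bullet> z))" "z \<noteq> 0" for z w \<tau>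
  proof -
    have "2 * (z \<bullet> h) = - (1 - \<delta>) * \<tau> * (z \<bullet> z)"
      using that W by simp
    then have "2 * \<gamma> * (w * (z \<bullet> h)) = - (w * \<tau>) * (z \<bullet> z)"
      using \<gamma> by algebra
    then show ?thesis
      using \<open>z \<noteq> 0\<close> by (simp add: nonzero_divide_eq_eq)
  qed
  have "W *\<^sub>R h = (2 * \<gamma>) *\<^sub>R ((w1 * (y1 \<bullet> h) / (y1 \<bullet> y1)) *\<^sub>R y1
    + (w2 * (y2 \<bullet> h) / (y2 \<bullet> y2)) *\<^sub>R y2 + (w3 * (y3 \<bullet> h) / (y3 \<bullet> y3)) *\<^sub>R y3)"
    unfolding scaleR_add_right scaleR_scaleR ratio[OF 1 y(1)] ratio[OF 2 y(2)] ratio[OF 3 y(3)] Wh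
    by (simp add: algebra_simps)
  moreover have "h \<noteq> 0"
  proof
    assume "h = 0"
    then have "\<tau>1 = 0" "\<tau>2 = 0" "\<tau>3 = 0"
      using 1 2 3 W \<delta>1 y by auto
    then show False
      using v_nz by (simp add: \<tau>1_def \<tau>2_def)
  qed
  ultimately show thesis
    using that unfolding W_def by blast
qed

section \<open>Derivatives of the potential off the charges\<close>

lemma norm_powr_has_derivative:
  fixes x q :: "'a::real_inner"
  assumes "x \<noteq> q"
  shows "((\<lambda>z. ((norm (z - q))\<^sup>2) powr r) has_derivative
    (\<lambda>h. 2 * ((x - q) \<bullet> h) * (r * ((norm (x - q))\<^sup>2) powr (r - 1)))) (at x)"
proof (rule DERIV_compose_FDERIV[where f = "\<lambda>t. t powr r" and g = "\<lambda>z. (norm (z - q))\<^sup>2"])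
  show "((\<lambda>t. t powr r) has_real_derivative r * ((norm (x - q))\<^sup>2) powr (r - 1)) (at ((norm (x - q))\<^sup>2))"
    by (rule has_real_derivative_powr) (use assms in simp)
  show "((\<lambda>z. (norm (z - q))\<^sup>2) has_derivative (\<lambda>h. 2 * ((x - q) \<bullet> h))) (at x)"
    unfolding power2_norm_eq_inner
    by (auto intro!: derivative_eq_intros simp: inner_commute)
qed

definition charge_weight :: "real \<Rightarrow> (nat \<Rightarrow> real) \<Rightarrow> (nat \<Rightarrow> real ^ 'n) \<Rightarrow> real ^ 'n \<Rightarrow> nat \<Rightarrow> real" where
  "charge_weight \<alpha> \<zeta> p x i = \<zeta> i * ((norm (x - p i))\<^sup>2) powr (- \<alpha> - 1)"

lemma GDERIV_potential:
  fixes p :: "nat \<Rightarrow> real ^ 'n"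
  assumes "x \<notin> p ` {1..3}"
  shows "GDERIV (potential \<alpha> \<zeta> p) x :> (- 2 * \<alpha>) *\<^sub>R (\<Sum>i=1..3. charge_weight \<alpha> \<zeta> p x i *\<^sub>R (x - p i))"
proof -
  have "(potential \<alpha> \<zeta> p has_derivative
    (\<lambda>h. \<Sum>i=1..3. \<zeta> i * (2 * ((x - p i) \<bullet> h) * (- \<alpha> * ((norm (x - p i))\<^sup>2) powr (- \<alpha> - 1))))) (at x)"
    unfolding potential_def
    by (intro has_derivative_sum has_derivative_mult_right norm_powr_has_derivative) (use assms in auto)
  moreover have "(\<Sum>i=1..3. \<zeta> i * (2 * ((x - p i) \<bullet> h) * (- \<alpha> * ((norm (x - p i))\<^sup>2) powr (- \<alpha> - 1))))
    = h \<bullet> ((- 2 * \<alpha>) *\<^sub>R (\<Sum>i=1..3. charge_weight \<alpha> \<zeta> p x i *\<^sub>R (x - p i)))" for h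
    unfolding inner_scaleR_right inner_sum_right sum_distrib_left
    by (intro sum.cong refl) (simp add: charge_weight_def inner_commute[of h])
  ultimately show ?thesis
    unfolding gderiv_def by simp
qed

lemma equilibrium_weights:
  fixes p :: "nat \<Rightarrow> real ^ 'n"
  assumes "equilibrium \<alpha> \<zeta> p x" "\<alpha> > 0"
  shows "(\<Sum>i=1..3. charge_weight \<alpha> \<zeta> p x i *\<^sub>R (x - p i)) = 0"
proof -
  have "x \<notin> p ` {1..3}" and 0: "GDERIV (potential \<alpha> \<zeta> p) x :> 0"
    using assms by (auto simp: equilibrium_def)
  have "(- 2 * \<alpha>) *\<^sub>R (\<Sum>i=1..3. charge_weight \<alpha> \<zeta> p x i *\<^sub>R (x - p i)) = 0"
    using gradient_eqI[OF GDERIV_potential[OF \<open>x \<notin> p ` {1..3}\<close>]] gradient_eqI[OF 0] by metis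
  then show ?thesis
    using assms(2) by simp
qed

lemma gradient_potential_has_derivative:
  fixes p :: "nat \<Rightarrow> real ^ 'n"
  assumes "x \<notin> p ` {1..3}"
  shows "(gradient (potential \<alpha> \<zeta> p) has_derivative (\<lambda>h. (- 2 * \<alpha>) *\<^sub>R (\<Sum>i=1..3. charge_weight \<alpha> \<zeta> p x i *\<^sub>R h
    - (2 * (\<alpha> + 1) * (charge_weight \<alpha> \<zeta> p x i * ((x - p i) \<bullet> h) / ((x - p i) \<bullet> (x - p i)))) *\<^sub>R (x - p i)))) (at x)"
proof -
  have d: "((\<lambda>z. (- 2 * \<alpha>) *\<^sub>R (\<Sum>i=1..3. charge_weight \<alpha> \<zeta> p z i *\<^sub>R (z - p i))) has_derivative
    (\<lambda>h. (- 2 * \<alpha>) *\<^sub>R (\<Sum>i=1..3. charge_weight \<alpha> \<zeta> p x i *\<^sub>R h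
      + (\<zeta> i * (2 * ((x - p i) \<bullet> h) * ((- \<alpha> - 1) * ((norm (x - p i))\<^sup>2) powr (- \<alpha> - 1 - 1)))) *\<^sub>R (x - p i)))) (at x)"
    unfolding charge_weight_def
    by (intro has_derivative_scaleR_right has_derivative_sum has_derivative_scaleR
        has_derivative_mult_right norm_powr_has_derivative)
      (use assms in \<open>auto intro!: derivative_eq_intros\<close>)
  have c: "\<zeta> i * (2 * ((x - p i) \<bullet> h) * ((- \<alpha> - 1) * ((norm (x - p i))\<^sup>2) powr (- \<alpha> - 1 - 1)))
    = - (2 * (\<alpha> + 1) * (charge_weight \<alpha> \<zeta> p x i * ((x - p i) \<bullet> h) / ((x - p i) \<bullet> (x - p i))))"
    if "i \<in> {1..3}" for i h
  proof -
    have "(norm (x - p i))\<^sup>2 > 0"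
      using assms that by auto
    then have "((norm (x - p i))\<^sup>2) powr (- \<alpha> - 1 - 1)
      = ((norm (x - p i))\<^sup>2) powr (- \<alpha> - 1) / ((x - p i) \<bullet> (x - p i))"
      by (subst powr_diff) (simp add: power2_norm_eq_inner)
    moreover have "z * (2 * t * ((- a - 1) * (P / N))) = - (2 * (a + 1) * (z * P * t / N))" for z t a P N :: real
      by (simp add: divide_inverse algebra_simps)
    ultimately show ?thesis
      by (simp only: charge_weight_def)
  qed
  have eq: "(\<Sum>i=1..3. charge_weight \<alpha> \<zeta> p x i *\<^sub>R h
      + (\<zeta> i * (2 * ((x - p i) \<bullet> h) * ((- \<alpha> - 1) * ((norm (x - p i))\<^sup>2) powr (- \<alpha> - 1 - 1)))) *\<^sub>R (x - p i))
    = (\<Sum>i=1..3. charge_weight \<alpha> \<zeta> p x i *\<^sub>R h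
      - (2 * (\<alpha> + 1) * (charge_weight \<alpha> \<zeta> p x i * ((x - p i) \<bullet> h) / ((x - p i) \<bullet> (x - p i)))) *\<^sub>R (x - p i))" for h
    by (intro sum.cong refl) (simp only: c scaleR_minus_left add_uminus_conv_diff)
  have "((\<lambda>z. (- 2 * \<alpha>) *\<^sub>R (\<Sum>i=1..3. charge_weight \<alpha> \<zeta> p z i *\<^sub>R (z - p i))) has_derivative
    (\<lambda>h. (- 2 * \<alpha>) *\<^sub>R (\<Sum>i=1..3. charge_weight \<alpha> \<zeta> p x i *\<^sub>R h
      - (2 * (\<alpha> + 1) * (charge_weight \<alpha> \<zeta> p x i * ((x - p i) \<bullet> h) / ((x - p i) \<bullet> (x - p i)))) *\<^sub>R (x - p i)))) (at x)"
    using d unfolding eq .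
  then show ?thesis
  proof (rule has_derivative_transform_within_open)
    show "open (- p ` {1..3})"
      by (simp add: open_Compl finite_imp_closed)
    show "x \<in> - p ` {1..3}"
      using assms by simp
    show "(- 2 * \<alpha>) *\<^sub>R (\<Sum>i=1..3. charge_weight \<alpha> \<zeta> p z i *\<^sub>R (z - p i)) = gradient (potential \<alpha> \<zeta> p) z"
      if "z \<in> - p ` {1..3}" for z
      using that by (intro gradient_eqI[OF GDERIV_potential, symmetric]) blast
  qed
qed

text \<open>The equation for \<open>h\<close> says that the Hessian maps \<open>h\<close> to
  zero.\<close>

lemma nondegenerate_injective:
  fixes p :: "nat \<Rightarrow> real ^ 'n"
  assumes "nondegenerate_equilibrium \<alpha> \<zeta> p x"
    and "(\<Sum>i=1..3. charge_weight \<alpha> \<zeta> p x i) *\<^sub>R h = (2 * (\<alpha> + 1)) *\<^sub>R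
      (\<Sum>i=1..3. (charge_weight \<alpha> \<zeta> p x i * ((x - p i) \<bullet> h) / ((x - p i) \<bullet> (x - p i))) *\<^sub>R (x - p i))"
  shows "h = 0"
proof -
  have x: "x \<notin> p ` {1..3}" and inv: "invertible (hessian (potential \<alpha> \<zeta> p) x)"
    using assms(1) by (auto simp: nondegenerate_equilibrium_def equilibrium_def)
  let ?D = "\<lambda>h. (- 2 * \<alpha>) *\<^sub>R (\<Sum>i=1..3. charge_weight \<alpha> \<zeta> p x i *\<^sub>R h
    - (2 * (\<alpha> + 1) * (charge_weight \<alpha> \<zeta> p x i * ((x - p i) \<bullet> h) / ((x - p i) \<bullet> (x - p i)))) *\<^sub>R (x - p i))"
  have D: "(gradient (potential \<alpha> \<zeta> p) has_derivative ?D) (at x)"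
    by (rule gradient_potential_has_derivative[OF x])
  have lin: "linear ?D"
    by (rule has_derivative_linear[OF D])
  have "hessian (potential \<alpha> \<zeta> p) x = matrix ?D"
    by (rule hessian_eqI) (simp only: matrix_vector_mul(2)[OF lin] D)
  then have "hessian (potential \<alpha> \<zeta> p) x *v h = ?D h"
    using fun_cong[OF matrix_vector_mul(2)[OF lin], of h] by (simp only:)
  also have "\<dots> = 0"
    using assms(2) by (simp add: sum_subtractf scaleR_left.sum[symmetric] scaleR_right.sum)
  finally show ?thesis
    using inv by (metis invertible_def matrix_vector_mul_assoc matrix_vector_mul_lid matrix_vector_mult_0_right)
qed

lemma sum_1_3: "(\<Sum>i=1..3. f i) = f 1 + f 2 + f (3 :: nat)" for f :: "nat \<Rightarrow> 'a::comm_monoid_add"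
proof -
  have "{1..3} = {1, 2, 3 :: nat}"
    by auto
  then show ?thesis
    by (simp add: add.assoc)
qed

lemma charge_weight_pos:
  assumes "\<zeta> i > 0" "x \<noteq> p i"
  shows "charge_weight \<alpha> \<zeta> p x i > 0"
  using assms by (simp add: charge_weight_def)

text \<open>On a line the force exerted by each charge is decreasing on either side of it, so an equilibrium is
  determined by the set of charges to its left.\<close>

lemma force_decreasing:
  fixes s t \<alpha> :: real
  assumes "\<alpha> > 0" "s < t" "0 < s \<longleftrightarrow> 0 < t" "s \<noteq> 0" "t \<noteq> 0"
  shows "t * (t\<^sup>2) powr (- \<alpha> - 1) < s * (s\<^sup>2) powr (- \<alpha> - 1)"
proof -
  have pos: "r * (r\<^sup>2) powr (- \<alpha> - 1) = r powr (- 2 * \<alpha> - 1)" if "r > 0" for r :: real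
  proof -
    have "(r\<^sup>2) powr (- \<alpha> - 1) = (r powr 2) powr (- \<alpha> - 1)"
      using that by simp
    also have "\<dots> = r powr (2 * (- \<alpha> - 1))"
      by (rule powr_powr)
    finally have "r * (r\<^sup>2) powr (- \<alpha> - 1) = r powr 1 * r powr (2 * (- \<alpha> - 1))"
      using that by simp
    also have "\<dots> = r powr (1 + 2 * (- \<alpha> - 1))"
      by (rule powr_add[symmetric])
    also have "1 + 2 * (- \<alpha> - 1) = - 2 * \<alpha> - 1"
      by simp
    finally show ?thesis .
  qed
  show ?thesis
  proof (cases "0 < s")
    case True
    then show ?thesis
      using assms by (simp add: pos powr_less_mono2_neg)
  next
    case False
    then have "- t > 0" "- s > 0"
      using assms by auto
    then show ?thesis
      using pos[of "- t"] pos[of "- s"] powr_less_mono2_neg[of "- 2 * \<alpha> - 1" "- t" "- s"] assms by simp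
  qed
qed

text \<open>The set of charges to the left determines the equilibrium. It is neither empty nor
  everything, since then all forces would point the same way; this leaves 2^3 - 2 = 6 sets.\<close>

lemma card_collinear:
  fixes p :: "nat \<Rightarrow> real ^ 'n" and e :: "real ^ 'n" and t :: "nat \<Rightarrow> real"
  assumes \<alpha>: "\<alpha> > 0" and \<zeta>: "\<And>i. i \<in> {1..3} \<Longrightarrow> \<zeta> i > 0"
    and p: "\<And>i. i \<in> {1..3} \<Longrightarrow> p i = p 1 + t i *\<^sub>R e" and e: "e \<noteq> 0"
  shows "finite {x. equilibrium \<alpha> \<zeta> p x} \<and> card {x. equilibrium \<alpha> \<zeta> p x} \<le> 6"
proof -
  let ?E = "{x. equilibrium \<alpha> \<zeta> p x}"
  let ?I = "{1, 2, 3 :: nat}"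
  have I: "{1..3} = ?I"
    by auto
  define f where "f s = s * (s\<^sup>2) powr (- \<alpha> - 1)" for s :: real
  have pos_e: "(norm e)\<^sup>2 powr (- \<alpha> - 1) > 0"
    using e by simp
  have coord: "\<exists>s. x = p 1 + s *\<^sub>R e \<and> (\<forall>i\<in>?I. s \<noteq> t i) \<and> (\<Sum>i\<in>?I. \<zeta> i * f (s - t i)) = 0"
    if "x \<in> ?E" for x
  proof -
    have x: "x \<notin> p ` ?I" and eq: "(\<Sum>i\<in>?I. charge_weight \<alpha> \<zeta> p x i *\<^sub>R (x - p i)) = 0"
      using that equilibrium_weights[of \<alpha> \<zeta> p x] \<alpha> unfolding I[symmetric] by (auto simp: equilibrium_def)
    let ?w = "charge_weight \<alpha> \<zeta> p x"
    have w: "?w i > 0" if "i \<in> ?I" for i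
      by (intro charge_weight_pos \<zeta>) (use x that I in auto)
    define W where "W = (\<Sum>i\<in>?I. ?w i)"
    have W: "W > 0"
      unfolding W_def by (rule sum_pos) (use w in auto)
    \<comment> \<open>The coordinate of the weighted barycentre of the charges, which an equilibrium
      must be; so it lies on the line.\<close>
    define s where "s = (\<Sum>i\<in>?I. ?w i * t i) / W"
    have p': "p i = p 1 + t i *\<^sub>R e" if "i \<in> ?I" for i
      by (rule p) (use that in auto)
    have "?w i *\<^sub>R (x - p i) = ?w i *\<^sub>R (x - p 1) - (?w i * t i) *\<^sub>R e" if "i \<in> ?I" for i
      by (subst p'[OF that]) (simp add: algebra_simps)
    then have "(\<Sum>i\<in>?I. ?w i *\<^sub>R (x - p i)) = (\<Sum>i\<in>?I. ?w i *\<^sub>R (x - p 1) - (?w i * t i) *\<^sub>R e)"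
      by (intro sum.cong refl)
    also have "\<dots> = W *\<^sub>R (x - p 1) - (\<Sum>i\<in>?I. ?w i * t i) *\<^sub>R e"
      by (simp only: W_def sum_subtractf scaleR_left.sum)
    finally have "W *\<^sub>R (x - p 1) = (W * s) *\<^sub>R e"
      unfolding eq using W by (simp add: s_def)
    then have "W *\<^sub>R (x - p 1) = W *\<^sub>R (s *\<^sub>R e)"
      by simp
    then have x_eq: "x = p 1 + s *\<^sub>R e"
      using W by (simp only: scaleR_cancel_left) (simp add: algebra_simps)
    have diff: "x - p i = (s - t i) *\<^sub>R e" if "i \<in> ?I" for i
      by (subst p'[OF that]) (simp add: x_eq algebra_simps)
    have ne: "s \<noteq> t i" if "i \<in> ?I" for i
      using diff[OF that] x that by auto
    have force: "?w i *\<^sub>R (x - p i) = ((norm e)\<^sup>2 powr (- \<alpha> - 1) * (\<zeta> i * f (s - t i))) *\<^sub>R e"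
      if "i \<in> ?I" for i
      unfolding charge_weight_def diff[OF that] f_def by (simp add: power_mult_distrib powr_mult)
    have "(\<Sum>i\<in>?I. ?w i *\<^sub>R (x - p i)) = (\<Sum>i\<in>?I. ((norm e)\<^sup>2 powr (- \<alpha> - 1) * (\<zeta> i * f (s - t i))) *\<^sub>R e)"
      by (rule sum.cong[OF refl force])
    also have "\<dots> = ((norm e)\<^sup>2 powr (- \<alpha> - 1) * (\<Sum>i\<in>?I. \<zeta> i * f (s - t i))) *\<^sub>R e"
      by (simp only: scaleR_left.sum sum_distrib_left)
    finally have "(\<Sum>i\<in>?I. \<zeta> i * f (s - t i)) = 0"
      unfolding eq using e pos_e by simp
    then show ?thesis
      using x_eq ne by blast
  qed
  then have "\<forall>x\<in>?E. \<exists>s. x = p 1 + s *\<^sub>R e \<and> (\<forall>i\<in>?I. s \<noteq> t i) \<and> (\<Sum>i\<in>?I. \<zeta> i * f (s - t i)) = 0" ..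
  from bchoice[OF this] obtain c where "\<forall>x\<in>?E. x = p 1 + c x *\<^sub>R e \<and> (\<forall>i\<in>?I. c x \<noteq> t i) \<and> (\<Sum>i\<in>?I. \<zeta> i * f (c x - t i)) = 0" ..
  then have c: "\<And>x. x \<in> ?E \<Longrightarrow> x = p 1 + c x *\<^sub>R e"
    "\<And>x i. x \<in> ?E \<Longrightarrow> i \<in> ?I \<Longrightarrow> c x \<noteq> t i" "\<And>x. x \<in> ?E \<Longrightarrow> (\<Sum>i\<in>?I. \<zeta> i * f (c x - t i)) = 0"
    by blast+
  define \<sigma> where "\<sigma> x = {i \<in> ?I. t i < c x}" for x
  have \<zeta>I: "\<zeta> i > 0" if "i \<in> ?I" for i
    using \<zeta> that I by blast
  have f_sign: "0 < s \<Longrightarrow> 0 < f s" "s < 0 \<Longrightarrow> f s < 0" for s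
    by (auto simp: f_def mult_neg_pos)
  have no_less: "\<not> c x < c y" if xy: "x \<in> ?E" "y \<in> ?E" "\<sigma> x = \<sigma> y" for x y
  proof
    assume "c x < c y"
    have "(\<Sum>i\<in>?I. \<zeta> i * f (c y - t i)) < (\<Sum>i\<in>?I. \<zeta> i * f (c x - t i))"
    proof (rule sum_strict_mono)
      fix i
      assume i: "i \<in> ?I"
      have "t i < c x \<longleftrightarrow> t i < c y"
        using xy(3) i unfolding \<sigma>_def by blast
      then have "f (c y - t i) < f (c x - t i)"
        unfolding f_def using \<alpha> \<open>c x < c y\<close> c(2)[OF xy(1) i] c(2)[OF xy(2) i]
        by (intro force_decreasing) auto
      then show "\<zeta> i * f (c y - t i) < \<zeta> i * f (c x - t i)"
        using \<zeta>I[OF i] by simp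
    qed auto
    then show False
      using c(3) xy by simp
  qed
  have "inj_on \<sigma> ?E"
  proof (rule inj_onI)
    fix x y
    assume xy: "x \<in> ?E" "y \<in> ?E" "\<sigma> x = \<sigma> y"
    have "c x = c y"
      using no_less[OF xy] no_less[OF xy(2,1) xy(3)[symmetric]] by linarith
    then show "x = y"
      using c(1)[OF xy(1)] c(1)[OF xy(2)] by simp
  qed
  moreover have "\<sigma> ` ?E \<subseteq> Pow ?I - {{}, ?I}"
  proof (rule image_subsetI)
    fix x
    assume x: "x \<in> ?E"
    have "\<sigma> x \<noteq> {}"
    proof
      assume "\<sigma> x = {}"
      then have "c x < t i" if "i \<in> ?I" for i
        using c(2)[OF x that] that unfolding \<sigma>_def by force
      then have "\<zeta> i * f (c x - t i) < 0" if "i \<in> ?I" for i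
        using mult_pos_neg[OF \<zeta>I[OF that] f_sign(2)[of "c x - t i"]] that by simp
      then have "(\<Sum>i\<in>?I. \<zeta> i * f (c x - t i)) < (\<Sum>i\<in>?I. 0)"
        by (intro sum_strict_mono) blast+
      then show False
        using c(3)[OF x] by simp
    qed
    moreover have "\<sigma> x \<noteq> ?I"
    proof
      assume "\<sigma> x = ?I"
      then have "t i < c x" if "i \<in> ?I" for i
        using that unfolding \<sigma>_def by blast
      then have "0 < \<zeta> i * f (c x - t i)" if "i \<in> ?I" for i
        using mult_pos_pos[OF \<zeta>I[OF that] f_sign(1)[of "c x - t i"]] that by simp
      then have "(\<Sum>i\<in>?I. 0) < (\<Sum>i\<in>?I. \<zeta> i * f (c x - t i))"
        by (intro sum_strict_mono) blast+
      then show False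
        using c(3)[OF x] by simp
    qed
    ultimately show "\<sigma> x \<in> Pow ?I - {{}, ?I}"
      unfolding \<sigma>_def by blast
  qed
  moreover have "card (Pow ?I - {{}, ?I}) = 6"
    by (subst card_Diff_subset) (auto simp: card_Pow)
  ultimately show ?thesis
    by (metis card_inj_on_le finite_Diff finite_Pow_iff finite.emptyI finite_imageD finite_insert finite_subset)
qed

section \<open>Non-collinear charges\<close>

text \<open>The \<open>g\<close> are inner products of y_i = x - p_i. Both formulas rest on W y_1 =
  w_2 (p_2 - p_1) + w_3 (p_3 - p_1), with W the total weight: the first is the squared norm, the
  second the inner product with the difference of the two summands.\<close>

lemma barycentric_gram:
  fixes w1 w2 w3 g11 g12 g13 g22 g23 g33 k1 k2 k3 :: real
  assumes "w1 * g11 + w2 * g12 + w3 * g13 = 0" "w1 * g12 + w2 * g22 + w3 * g23 = 0"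
    "w1 * g13 + w2 * g23 + w3 * g33 = 0"
    and k: "k1 = g11 - g12 - g13 + g23" "k2 = g22 - g12 - g23 + g13" "k3 = g33 - g13 - g23 + g12"
  shows "(k1 + k2) * w2\<^sup>2 + (k1 + k3) * w3\<^sup>2 + 2 * k1 * w2 * w3 = (w1 + w2 + w3)\<^sup>2 * g11"
    and "(k1 + k2) * w2\<^sup>2 - (k1 + k3) * w3\<^sup>2 = (w1 + w2 + w3) * ((w2 - w3) * g11 - w2 * g12 + w3 * g13)"
  unfolding k using assms(1-3) by algebra+

text \<open>The map \<Theta> sends an equilibrium to its coordinates (p, r). It is injective,
  because weight ratios determine the barycentre, and its values solve the separated system.\<close>

lemma (in triangle) card_nondegenerate:
  fixes p :: "nat \<Rightarrow> real ^ 'n"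
  assumes \<alpha>: "\<alpha> > 0" and \<zeta>: "\<And>i. i \<in> {1..3} \<Longrightarrow> \<zeta> i > 0"
    and k: "k1 = (p 2 - p 1) \<bullet> (p 3 - p 1)" "k2 = (p 3 - p 2) \<bullet> (p 1 - p 2)" "k3 = (p 1 - p 3) \<bullet> (p 2 - p 3)"
  shows "finite {x. nondegenerate_equilibrium \<alpha> \<zeta> p x} \<and> card {x. nondegenerate_equilibrium \<alpha> \<zeta> p x} \<le> 6"
proof -
  interpret T: log_kernel_triple K1.L K1.l K1.m K2.L K2.l K2.m K3.L K3.l K3.m
    by (rule triple)
  let ?N = "{x. nondegenerate_equilibrium \<alpha> \<zeta> p x}"
  let ?w = "charge_weight \<alpha> \<zeta> p"
  define \<gamma> where "\<gamma> = \<alpha> + 1"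
  define \<delta> where "\<delta> = \<alpha> / (\<alpha> + 1)"
  define c where "c = (ln (\<zeta> 1) - ln (\<zeta> 3)) / \<gamma>"
  define d where "d = (ln (\<zeta> 1) - ln (\<zeta> 2)) / \<gamma>"
  have \<gamma>: "\<gamma> > 0"
    using \<alpha> by (simp add: \<gamma>_def)
  have \<delta>: "\<delta> = 1 - 1 / \<gamma>" "\<gamma> * (1 - \<delta>) = 1" "\<bar>\<delta>\<bar> < 1"
    using \<alpha> by (auto simp: \<delta>_def \<gamma>_def field_simps)
  define \<Theta> where "\<Theta> x = (ln (?w x 2) - ln (?w x 3), ln (?w x 1) - ln (?w x 2))" for x
  have bary: "?w x 1 *\<^sub>R (x - p 1) + ?w x 2 *\<^sub>R (x - p 2) + ?w x 3 *\<^sub>R (x - p 3) = 0"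
    and w_pos: "?w x 1 > 0" "?w x 2 > 0" "?w x 3 > 0" and ne: "x \<noteq> p 1" "x \<noteq> p 2" "x \<noteq> p 3"
    if "x \<in> ?N" for x
  proof -
    have eq: "equilibrium \<alpha> \<zeta> p x"
      using that by (simp add: nondegenerate_equilibrium_def)
    then show "x \<noteq> p 1" "x \<noteq> p 2" "x \<noteq> p 3"
      by (auto simp: equilibrium_def)
    then show "?w x 1 > 0" "?w x 2 > 0" "?w x 3 > 0"
      by (auto intro!: charge_weight_pos \<zeta>)
    show "?w x 1 *\<^sub>R (x - p 1) + ?w x 2 *\<^sub>R (x - p 2) + ?w x 3 *\<^sub>R (x - p 3) = 0"
      using equilibrium_weights[OF eq \<alpha>] unfolding sum_1_3 .
  qed
  have sol: "\<Theta> x \<in> T.solutions \<delta> c d" if x: "x \<in> ?N" for x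
  proof -
    define y1 y2 y3 where "y1 = x - p 1" and "y2 = x - p 2" and "y3 = x - p 3"
    define w1 w2 w3 where "w1 = ?w x 1" and "w2 = ?w x 2" and "w3 = ?w x 3"
    define W where "W = w1 + w2 + w3"
    have w: "w1 > 0" "w2 > 0" "w3 > 0"
      using w_pos[OF x] by (auto simp: w1_def w2_def w3_def)
    then have W: "W > 0"
      by (simp add: W_def)
    have y: "y1 \<noteq> 0" "y2 \<noteq> 0" "y3 \<noteq> 0"
      using ne[OF x] by (auto simp: y1_def y2_def y3_def)
    have b: "w1 *\<^sub>R y1 + w2 *\<^sub>R y2 + w3 *\<^sub>R y3 = 0"
      using bary[OF x] by (simp add: w1_def w2_def w3_def y1_def y2_def y3_def)
    have g: "w1 * (y1 \<bullet> z) + w2 * (y2 \<bullet> z) + w3 * (y3 \<bullet> z) = 0" for z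
      using arg_cong[OF b, of "\<lambda>v. v \<bullet> z"] by (simp add: inner_add_left)
    have ky: "k1 = (y1 - y2) \<bullet> (y1 - y3)" "k2 = (y2 - y3) \<bullet> (y2 - y1)" "k3 = (y3 - y1) \<bullet> (y3 - y2)"
      unfolding k by (auto simp: y1_def y2_def y3_def)
    have gram: "w1 * (y1 \<bullet> y1) + w2 * (y1 \<bullet> y2) + w3 * (y1 \<bullet> y3) = 0"
      "w1 * (y1 \<bullet> y2) + w2 * (y2 \<bullet> y2) + w3 * (y2 \<bullet> y3) = 0"
      "w1 * (y1 \<bullet> y3) + w2 * (y2 \<bullet> y3) + w3 * (y3 \<bullet> y3) = 0"
      using g[of y1] g[of y2] g[of y3]
      unfolding inner_commute[of y2 y1] inner_commute[of y3 y1] inner_commute[of y3 y2] .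
    have kg: "k1 = y1 \<bullet> y1 - y1 \<bullet> y2 - y1 \<bullet> y3 + y2 \<bullet> y3"
      "k2 = y2 \<bullet> y2 - y1 \<bullet> y2 - y2 \<bullet> y3 + y1 \<bullet> y3"
      "k3 = y3 \<bullet> y3 - y1 \<bullet> y3 - y2 \<bullet> y3 + y1 \<bullet> y2"
      unfolding ky inner_diff_left inner_diff_right inner_commute[of y2 y1] inner_commute[of y3 y1]
        inner_commute[of y3 y2] by linarith+
    have W_eq: "w1 + w2 + w3 = W" "w2 + w3 + w1 = W" "w3 + w1 + w2 = W"
      by (simp_all add: W_def)
    have e1: "(k1 + k2) * w2\<^sup>2 + (k1 + k3) * w3\<^sup>2 + 2 * k1 * w2 * w3 = W\<^sup>2 * (y1 \<bullet> y1)"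
      "(k1 + k2) * w2\<^sup>2 - (k1 + k3) * w3\<^sup>2 = W * ((w2 - w3) * (y1 \<bullet> y1) - w2 * (y1 \<bullet> y2) + w3 * (y1 \<bullet> y3))"
      using barycentric_gram[of w1 "y1 \<bullet> y1" w2 "y1 \<bullet> y2" w3 "y1 \<bullet> y3" "y2 \<bullet> y2" "y2 \<bullet> y3" "y3 \<bullet> y3" k1 k2 k3]
        gram kg unfolding W_eq by linarith+
    have e2: "(k2 + k3) * w3\<^sup>2 + (k2 + k1) * w1\<^sup>2 + 2 * k2 * w3 * w1 = W\<^sup>2 * (y2 \<bullet> y2)"
      "(k2 + k3) * w3\<^sup>2 - (k2 + k1) * w1\<^sup>2 = W * ((w3 - w1) * (y2 \<bullet> y2) - w3 * (y2 \<bullet> y3) + w1 * (y1 \<bullet> y2))"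
      using barycentric_gram[of w2 "y2 \<bullet> y2" w3 "y2 \<bullet> y3" w1 "y1 \<bullet> y2" "y3 \<bullet> y3" "y1 \<bullet> y3" "y1 \<bullet> y1" k2 k3 k1]
        gram kg unfolding W_eq by linarith+
    have e3: "(k3 + k1) * w1\<^sup>2 + (k3 + k2) * w2\<^sup>2 + 2 * k3 * w1 * w2 = W\<^sup>2 * (y3 \<bullet> y3)"
      "(k3 + k1) * w1\<^sup>2 - (k3 + k2) * w2\<^sup>2 = W * ((w1 - w2) * (y3 \<bullet> y3) - w1 * (y1 \<bullet> y3) + w2 * (y2 \<bullet> y3))"
      using barycentric_gram[of w3 "y3 \<bullet> y3" w1 "y1 \<bullet> y3" w2 "y2 \<bullet> y3" "y1 \<bullet> y1" "y1 \<bullet> y2" "y2 \<bullet> y2" k3 k1 k2]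
        gram kg unfolding W_eq by linarith+
    define P Q R where "P = ln w2 - ln w3" and "Q = ln w3 - ln w1" and "R = ln w1 - ln w2"
    have Q: "- P - R = Q"
      by (simp add: P_def Q_def R_def)
    note r1 = ratio_kernel[OF w(2,3) K1.cosh_kernel_axioms, folded P_def, unfolded e1]
    note r2 = ratio_kernel[OF w(3,1) K2.cosh_kernel_axioms, folded Q_def, unfolded e2]
    note r3 = ratio_kernel[OF w(1,2) K3.cosh_kernel_axioms, folded R_def, unfolded e3]
    have L: "ln (W\<^sup>2 * (z \<bullet> z)) = 2 * ln W + ln (z \<bullet> z)" if "z \<noteq> 0" for z :: "real ^ 'n"
      using W that by (simp add: ln_mult ln_realpow)
    have ln_weight: "ln (z * r powr (- \<alpha> - 1)) = ln z - \<gamma> * ln r" if "z > 0" "r > 0" for z r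
      using that by (simp add: ln_mult ln_powr \<gamma>_def algebra_simps)
    have "ln (?w x i) = ln (\<zeta> i) - \<gamma> * ln ((x - p i) \<bullet> (x - p i))" if "i \<in> {1..3}" "x \<noteq> p i" for i
      unfolding charge_weight_def power2_norm_eq_inner by (rule ln_weight) (use \<zeta> that in auto)
    then have "ln ((x - p i) \<bullet> (x - p i)) = (ln (\<zeta> i) - ln (?w x i)) / \<gamma>" if "i \<in> {1..3}" "x \<noteq> p i" for i
      using that \<gamma> by (simp add: field_simps)
    from this[of 1] this[of 2] this[of 3]
    have ln_\<rho>: "ln (y1 \<bullet> y1) = (ln (\<zeta> 1) - ln w1) / \<gamma>" "ln (y2 \<bullet> y2) = (ln (\<zeta> 2) - ln w2) / \<gamma>"
      "ln (y3 \<bullet> y3) = (ln (\<zeta> 3) - ln w3) / \<gamma>"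
      using ne[OF x] by (auto simp: y1_def y2_def y3_def w1_def w2_def w3_def)
    \<comment> \<open>The terms ln W cancel, and ln w1 - ln w3 = P + R appears with the factor 1 - 1
      / \<gamma> = \<delta>.\<close>
    have "K1.L P - \<delta> * P = K3.L R + \<delta> * R + c"
      unfolding r1(3) r3(3) L[OF y(1)] L[OF y(3)] ln_\<rho> c_def \<delta>(1)
      unfolding P_def R_def by (simp add: diff_divide_distrib algebra_simps)
    moreover have "K1.L P + \<delta> * P = K2.L (- P - R) - \<delta> * (- P - R) + d"
      unfolding Q r1(3) r2(3) L[OF y(1)] L[OF y(2)] ln_\<rho> d_def \<delta>(1)
      unfolding P_def Q_def by (simp add: diff_divide_distrib algebra_simps)
    moreover have "T.critical_sum \<delta> P R \<noteq> 0"
    proof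
      \<comment> \<open>A zero of \<open>critical_sum\<close> yields a nonzero vector in the kernel
        of the Hessian.\<close>
      assume crit: "T.critical_sum \<delta> P R = 0"
      have l: "l * W * (z \<bullet> z) = n" if "l = W * n / (W\<^sup>2 * (z \<bullet> z))" "z \<noteq> 0" for l n and z :: "real ^ 'n"
        using that W by (simp add: power2_eq_square)
      obtain h where h: "h \<noteq> 0" "(w1 + w2 + w3) *\<^sub>R h = (2 * \<gamma>) *\<^sub>R ((w1 * (y1 \<bullet> h) / (y1 \<bullet> y1)) *\<^sub>R y1
          + (w2 * (y2 \<bullet> h) / (y2 \<bullet> y2)) *\<^sub>R y2 + (w3 * (y3 \<bullet> h) / (y3 \<bullet> y3)) *\<^sub>R y3)"
        by (rule degenerate_direction[OF w y b l[OF r1(1) y(1), unfolded W_def]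
              l[OF r2(1) y(2), unfolded W_def] l[OF r3(1) y(3), unfolded W_def] _ \<delta>(2)])
          (use crit in \<open>simp add: T.critical_sum_def Q\<close>)
      have "h = 0"
        by (rule nondegenerate_injective[of \<alpha> \<zeta> p x])
          (use x h(2) in \<open>auto simp only: sum_1_3 w1_def w2_def w3_def y1_def y2_def y3_def \<gamma>_def\<close>)
      then show False
        using h(1) by simp
    qed
    ultimately show ?thesis
      by (simp add: \<Theta>_def T.solutions_def P_def R_def w1_def w2_def w3_def)
  qed
  have "inj_on \<Theta> ?N"
  proof (rule inj_onI)
    fix x x'
    assume x: "x \<in> ?N" and x': "x' \<in> ?N" and eq: "\<Theta> x = \<Theta> x'"
    \<comment> \<open>Equal ratios make the weights proportional with factor \<open>t\<close>, which
      drops out of the barycentric relation.\<close>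
    define t where "t = ?w x' 2 / ?w x 2"
    have t: "t > 0"
      using w_pos[OF x] w_pos[OF x'] by (simp add: t_def)
    have "ln (?w x' 1) = ln (t * ?w x 1)" "ln (?w x' 3) = ln (t * ?w x 3)"
      using eq w_pos[OF x] w_pos[OF x'] by (auto simp: \<Theta>_def t_def ln_mult ln_div)
    then have w': "?w x' 1 = t * ?w x 1" "?w x' 2 = t * ?w x 2" "?w x' 3 = t * ?w x 3"
      using t w_pos[OF x] w_pos[OF x'] by (auto simp: t_def)
    let ?W = "?w x 1 + ?w x 2 + ?w x 3"
    have "t *\<^sub>R (?w x 1 *\<^sub>R (x' - p 1) + ?w x 2 *\<^sub>R (x' - p 2) + ?w x 3 *\<^sub>R (x' - p 3)) = 0"
      using bary[OF x'] unfolding w' by (simp add: scaleR_add_right)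
    then have "?w x 1 *\<^sub>R (x' - p 1) + ?w x 2 *\<^sub>R (x' - p 2) + ?w x 3 *\<^sub>R (x' - p 3) = 0"
      using t by simp
    then have "?W *\<^sub>R x = ?W *\<^sub>R x'"
      using bary[OF x] by (simp add: algebra_simps)
    then show "x = x'"
      using w_pos[OF x] by simp
  qed
  moreover have "\<Theta> ` ?N \<subseteq> T.solutions \<delta> c d"
    using sol by blast
  ultimately show ?thesis
    using T.card_solutions[OF \<delta>(3), of c d] by (meson card_inj_on_le finite_imageD finite_subset order_trans)
qed

section \<open>The dichotomy between collinear charges and a triangle\<close>

theorem theorem1p1:
  fixes p :: "nat \<Rightarrow> real ^ 'n" and \<zeta> :: "nat \<Rightarrow> real" and \<alpha> :: real
  assumes "CARD('n) \<ge> 2"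
    and "\<alpha> > 0"
    and "inj_on p {1..3}"
    and "\<And>i. i \<in> {1..3} \<Longrightarrow> \<zeta> i > 0"
  shows "finite {x. nondegenerate_equilibrium \<alpha> \<zeta> p x} \<and>
         card {x. nondegenerate_equilibrium \<alpha> \<zeta> p x} \<le> 6"
proof -
  have distinct: "p 1 \<noteq> p 2" "p 2 \<noteq> p 3" "p 3 \<noteq> p 1"
    using inj_onD[OF assms(3), of 1 2] inj_onD[OF assms(3), of 2 3] inj_onD[OF assms(3), of 3 1] by auto
  define a b where "a = p 2 - p 1" and "b = p 3 - p 1"
  define k1 k2 k3 where "k1 = (p 2 - p 1) \<bullet> (p 3 - p 1)" and "k2 = (p 3 - p 2) \<bullet> (p 1 - p 2)"
    and "k3 = (p 1 - p 3) \<bullet> (p 2 - p 3)"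
  have k: "k1 = a \<bullet> b" "k2 = a \<bullet> a - a \<bullet> b" "k3 = b \<bullet> b - a \<bullet> b"
    by (auto simp: k1_def k2_def k3_def a_def b_def inner_diff inner_commute algebra_simps)
  have sides: "k1 + k2 = a \<bullet> a" "k2 + k3 = (a - b) \<bullet> (a - b)" "k3 + k1 = b \<bullet> b"
    by (auto simp: k inner_diff inner_commute)
  have e2: "k1 * k2 + k2 * k3 + k1 * k3 = (a \<bullet> a) * (b \<bullet> b) - (a \<bullet> b)\<^sup>2"
    by (simp add: k algebra_simps power2_eq_square)
  have ab: "a \<noteq> 0" "b \<noteq> 0" "a - b \<noteq> 0"
    using distinct by (auto simp: a_def b_def)
  show ?thesis
  \<comment> \<open>Equality in the Cauchy-Schwarz inequality means collinear charges; otherwise its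
    defect is the square of twice the area.\<close>
  proof (cases "(a \<bullet> b)\<^sup>2 = (a \<bullet> a) * (b \<bullet> b)")
    case True
    \<comment> \<open>\<open>c *\<^sub>R a\<close> is the projection of \<open>b\<close> to the line
      of \<open>a\<close>; equality makes the remainder vanish.\<close>
    define c where "c = (a \<bullet> b) / (a \<bullet> a)"
    have c: "c * (a \<bullet> a) = a \<bullet> b"
      using ab by (simp add: c_def)
    have "(a \<bullet> a) * ((b - c *\<^sub>R a) \<bullet> (b - c *\<^sub>R a)) = (a \<bullet> a) * (b \<bullet> b) - 2 * (c * (a \<bullet> a)) * (a \<bullet> b) + (c * (a \<bullet> a))\<^sup>2"
      by (simp add: inner_diff inner_commute algebra_simps power2_eq_square)
    also have "\<dots> = 0"
      unfolding c using True by (simp add: power2_eq_square)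
    finally have b: "b = c *\<^sub>R a"
      using ab by simp
    have "finite {x. equilibrium \<alpha> \<zeta> p x} \<and> card {x. equilibrium \<alpha> \<zeta> p x} \<le> 6"
    proof (rule card_collinear[OF assms(2,4)])
      show "p i = p 1 + (if i = 1 then 0 else if i = 2 then 1 else c) *\<^sub>R a" if "i \<in> {1..3}" for i
      proof -
        have "i = 1 \<or> i = 2 \<or> i = 3"
          using that by auto
        then show ?thesis
          using b by (auto simp: a_def b_def algebra_simps)
      qed
    qed (use ab in auto)
    moreover have "{x. nondegenerate_equilibrium \<alpha> \<zeta> p x} \<subseteq> {x. equilibrium \<alpha> \<zeta> p x}"
      by (auto simp: nondegenerate_equilibrium_def)
    ultimately show ?thesis
      by (meson card_mono finite_subset order_trans)
  next
    case False
    then have "k1 * k2 + k2 * k3 + k1 * k3 > 0"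
      using Cauchy_Schwarz_ineq[of a b] unfolding e2 by simp
    then interpret triangle k1 k2 k3 "sqrt (k1 * k2 + k2 * k3 + k1 * k3)"
      using ab unfolding triangle_def sides by simp
    show ?thesis
      by (rule card_nondegenerate[OF assms(2,4) k1_def k2_def k3_def])
  qed
qed

end
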